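(* Let $z>0$ and let $(a_i)_{i\ge1}$, $(b_i)_{i\ge2}$ be positive numbers; put $Q_1=1$, $Q_i=\frac{a_1a_2\cdots a_{i-1}}{b_2\cdots b_i}$ for $i\ge2$, and assume $$\sum_{n=2}^\infty Q_nz^n\Big(\sum_{k=n}^\infty\frac1{a_kQ_kz^{k+1}}\Big)=\infty .$$ Let $n\ge2$. Then the distribution $\Pi_n^{\mathrm{qsd}}$ on $\mathcal E_n$ given by $$\Pi_n^{\mathrm{qsd}}(C)=\prod_{i=2}^n\frac{(f_i^n)^{C_i}}{C_i!}e^{-f_i^n},\quad C\in\mathcal E_n,\qquad f_i^n=J_nQ_iz^i\sum_{k=i}^n\frac1{a_kQ_kz^{k+1}},\qquad J_n=\Big(\sum_{k=1}^n\frac1{a_kQ_kz^{k+1}}\Big)^{-1},$$ is a quasi-stationary distribution for the Becker–Döring process $\mathbf C$ conditioned to stay in $\mathcal E_n$; namely, for all $t\ge0$, $$\mathbf P_{\Pi_n^{\mathrm{qsd}}}\{\mathbf C(t)\in\cdot\mid t<\tau_n\}=\Pi_n^{\mathrm{qsd}},$$ and moreover $$\mathbf P_{\Pi_n^{\mathrm{qsd}}}\{t<\tau_n\}=\exp(-J_nt).$$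
   Context: $\mathbb N_0=\{0,1,2,\ldots\}$, $\mathbb N_2=\{2,3,\ldots\}$. $\mathcal E=\ell^1(\mathbb N_2,\mathbb N_0)$ is the countable set of summable (hence finitely supported) $\mathbb N_0$-valued sequences $C=(C_2,C_3,\ldots)$, and $\mathcal E_n=\{C\in\mathcal E: C_i=0 \text{ for all } i\ge n+1\}$. Becker–Döring (BD) process: the continuous-time Markov chain $\mathbf C(t)=(C_2(t),C_3(t),\ldots)$ on $\mathcal E$ with generator $$\mathcal A\psi(C)=\sum_{i=1}^\infty\Big(a_izC_i[\psi(C+\Delta_i)-\psi(C)]+b_{i+1}C_{i+1}[\psi(C-\Delta_i)-\psi(C)]\Big),$$ with the convention $C_1=z$, and $\Delta_1=\mathbf e_2$, $\Delta_i=\mathbf e_{i+1}-\mathbf e_i$ for $i\ge2$, where $\mathbf e_2,\mathbf e_3,\ldots$ is the canonical basis. It is non-explosive under the divergence condition in the claim. $\mathbf P_\Pi$ denotes its law when $\mathbf C(0)\sim\Pi$. The exit time is $\tau_n=\inf\{t\ge0:\mathbf C(t)\notin\mathcal E_n\}$. *)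

theory Defs
  imports "HOL-Probability.Probability"
begin

section \<open>Continuous-time Markov chains on a countable state space\<close>

text \<open>
  A generator is given as an operator \<open>A\<close> on real functions of the state. Its matrix entries are
  \<open>q(x,y) = (A 1_y)(x)\<close>; the total jump rate out of \<open>x\<close> is \<open>-q(x,x)\<close>.
\<close>

definition exit_rate :: "(('s \<Rightarrow> real) \<Rightarrow> 's \<Rightarrow> real) \<Rightarrow> 's \<Rightarrow> real" where
  "exit_rate A x = - A (indicator {x}) x"

definition jump_prob :: "(('s \<Rightarrow> real) \<Rightarrow> 's \<Rightarrow> real) \<Rightarrow> 's \<Rightarrow> 's \<Rightarrow> real" where
  "jump_prob A x y = (if x = y then 0 else A (indicator {y}) x / exit_rate A x)"

text \<open>
  \<open>is_ctmc A E \<mu> M X\<close>: on the probability space \<open>M\<close>, the process \<open>X\<close> is the (minimal, right-continuous)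
  Markov chain on \<open>E\<close> with generator \<open>A\<close> and initial law \<open>\<mu>\<close>. Its jump chain \<open>Y\<close> is a
  discrete-time Markov chain with transition matrix \<open>jump_prob A\<close> and, conditionally on \<open>Y\<close>, the
  holding times \<open>S k\<close> are independent and exponential with parameters \<open>exit_rate A (Y k)\<close>; the
  formula for the cylinder probabilities states exactly this. The jump times are \<open>\<Sum>i<k. S i\<close>.

  The value \<open>None\<close> is the cemetery state, entered at the explosion time \<open>\<Sum>i. S i\<close> if that is finite,
  so that no assumption of non-explosion is built in. Holding times are real-valued, so the
  definition is meant for generators without absorbing states (\<open>exit_rate A x > 0\<close> on \<open>E\<close>).
\<close>

definition is_ctmc ::
  "(('s \<Rightarrow> real) \<Rightarrow> 's \<Rightarrow> real) \<Rightarrow> 's set \<Rightarrow> 's measure \<Rightarrow> 'w measure \<Rightarrow> (real \<Rightarrow> 'w \<Rightarrow> 's option) \<Rightarrow> bool"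
where
  "is_ctmc A E \<mu> M X \<longleftrightarrow> prob_space M \<and>
     (\<exists>(Y :: nat \<Rightarrow> 'w \<Rightarrow> 's) (S :: nat \<Rightarrow> 'w \<Rightarrow> real).
        (\<forall>k. Y k \<in> measurable M (count_space E)) \<and>
        (\<forall>k. S k \<in> borel_measurable M) \<and>
        (\<forall>k. \<forall>\<omega>\<in>space M. 0 < S k \<omega>) \<and>
        (\<forall>k x s. (\<forall>i\<le>k. x i \<in> E \<and> 0 \<le> s i) \<longrightarrow>
           measure M {\<omega>\<in>space M. \<forall>i\<le>k. Y i \<omega> = x i \<and> s i < S i \<omega>} =
             measure \<mu> {x 0} * (\<Prod>i<k. jump_prob A (x i) (x (Suc i)))
               * (\<Prod>i\<le>k. exp (- exit_rate A (x i) * s i))) \<and>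
        (\<forall>\<omega>\<in>space M. \<forall>t\<ge>0.
           (\<forall>k. (\<Sum>i<k. S i \<omega>) \<le> t \<and> t < (\<Sum>i<Suc k. S i \<omega>) \<longrightarrow> X t \<omega> = Some (Y k \<omega>)) \<and>
           ((\<forall>k. (\<Sum>i<k. S i \<omega>) \<le> t) \<longrightarrow> X t \<omega> = None)))"

definition exit_time :: "'s set \<Rightarrow> (real \<Rightarrow> 'w \<Rightarrow> 's option) \<Rightarrow> 'w \<Rightarrow> ereal" where
  "exit_time F X \<omega> = Inf (ereal ` {t. 0 \<le> t \<and> X t \<omega> \<notin> Some ` F})"


section \<open>The Becker--Doering process\<close>

text \<open>
  Sequences indexed by \<open>i \<ge> 2\<close> are functions on \<open>nat\<close> that vanish at \<open>0\<close> and \<open>1\<close>.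
\<close>

definition BD_states :: "(nat \<Rightarrow> nat) set" where
  "BD_states = {C. C 0 = 0 \<and> C 1 = 0 \<and> summable (\<lambda>i. real (C i))}"

definition BD_states_upto :: "nat \<Rightarrow> (nat \<Rightarrow> nat) set" where
  "BD_states_upto n = {C \<in> BD_states. \<forall>i\<ge>n+1. C i = 0}"

definition BD_Delta :: "nat \<Rightarrow> nat \<Rightarrow> int" where
  "BD_Delta i j = (if j = i + 1 then 1 else 0) - (if 2 \<le> i \<and> j = i then 1 else 0)"

text \<open>
  The truncation by \<open>nat\<close> has no effect in the generator below: whenever an entry of
  \<open>C + \<Delta>\<^sub>i\<close> or \<open>C - \<Delta>\<^sub>i\<close> would be negative, the corresponding rate is zero.
\<close>

definition BD_plus :: "(nat \<Rightarrow> nat) \<Rightarrow> (nat \<Rightarrow> int) \<Rightarrow> (nat \<Rightarrow> nat)" where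
  "BD_plus C D = (\<lambda>j. nat (int (C j) + D j))"

definition BD_minus :: "(nat \<Rightarrow> nat) \<Rightarrow> (nat \<Rightarrow> int) \<Rightarrow> (nat \<Rightarrow> nat)" where
  "BD_minus C D = (\<lambda>j. nat (int (C j) - D j))"

text \<open>The convention \<open>C\<^sub>1 = z\<close>.\<close>

definition BD_conc :: "real \<Rightarrow> (nat \<Rightarrow> nat) \<Rightarrow> nat \<Rightarrow> real" where
  "BD_conc z C i = (if i = 1 then z else real (C i))"

definition BD_generator ::
  "(nat \<Rightarrow> real) \<Rightarrow> (nat \<Rightarrow> real) \<Rightarrow> real \<Rightarrow> ((nat \<Rightarrow> nat) \<Rightarrow> real) \<Rightarrow> (nat \<Rightarrow> nat) \<Rightarrow> real" where
  "BD_generator a b z \<psi> C =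
     (\<Sum>\<^sub>\<infinity>i\<in>{1..}. a i * z * BD_conc z C i * (\<psi> (BD_plus C (BD_Delta i)) - \<psi> C)
        + b (i + 1) * BD_conc z C (i + 1) * (\<psi> (BD_minus C (BD_Delta i)) - \<psi> C))"

definition BD_Q :: "(nat \<Rightarrow> real) \<Rightarrow> (nat \<Rightarrow> real) \<Rightarrow> nat \<Rightarrow> real" where
  "BD_Q a b i = (\<Prod>k=1..<i. a k) / (\<Prod>k=2..i. b k)"

definition BD_J :: "(nat \<Rightarrow> real) \<Rightarrow> (nat \<Rightarrow> real) \<Rightarrow> real \<Rightarrow> nat \<Rightarrow> real" where
  "BD_J a b z n = inverse (\<Sum>k=1..n. 1 / (a k * BD_Q a b k * z ^ (k + 1)))"

definition BD_f :: "(nat \<Rightarrow> real) \<Rightarrow> (nat \<Rightarrow> real) \<Rightarrow> real \<Rightarrow> nat \<Rightarrow> nat \<Rightarrow> real" where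
  "BD_f a b z n i =
     BD_J a b z n * BD_Q a b i * z ^ i * (\<Sum>k=i..n. 1 / (a k * BD_Q a b k * z ^ (k + 1)))"

text \<open>A measure on all of \<open>BD_states\<close>, carried by \<open>BD_states_upto n\<close>.\<close>

definition BD_qsd :: "(nat \<Rightarrow> real) \<Rightarrow> (nat \<Rightarrow> real) \<Rightarrow> real \<Rightarrow> nat \<Rightarrow> (nat \<Rightarrow> nat) measure" where
  "BD_qsd a b z n = point_measure BD_states
     (\<lambda>C. if C \<in> BD_states_upto n
           then ennreal (\<Prod>i=2..n. BD_f a b z n i ^ C i / fact (C i) * exp (- BD_f a b z n i))
           else 0)"

end

theory Submission
  imports Defs
begin

text \<open>
  Write \<open>E\<^sub>n\<close> for the truncated state space, \<open>q y\<close> for the exit rate, \<open>\<nu>\<close> for the product of Poisson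
  laws with means \<open>f i\<close>, and \<open>J\<close> for the current. The theorem says that the process that starts from
  \<open>\<nu>\<close> and is killed when it leaves \<open>E\<^sub>n\<close> has the law \<open>exp (- J * t) * \<nu>\<close> at time \<open>t\<close>.

  There are two ingredients. The algebraic one is that \<open>\<nu>\<close> is a left eigenvector of the generator
  restricted to \<open>E\<^sub>n\<close> (\<open>\<nu>_balance\<close>): the sum of \<open>\<nu> x * q x y\<close> over all \<open>x\<close> in \<open>E\<^sub>n\<close> other than \<open>y\<close> is
  \<open>(q y - J) * \<nu> y\<close>. The means \<open>f i\<close> carry a constant current, \<open>a i * z * f i - b (i + 1) * f (i + 1) = J\<close>
  with \<open>f 1 = z\<close> and \<open>f (n + 1) = 0\<close> (\<open>flux\<close>, \<open>flux_last\<close>). A jump multiplies a product of Poisson weights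
  by a ratio of means and a ratio of cluster numbers, and the latter turns the jump rate at \<open>x\<close> into one
  that is linear in \<open>y\<close>. So the inflow into \<open>y\<close>, relative to \<open>\<nu> y\<close>, is an affine function of \<open>y\<close>, and the
  constancy of the current makes its difference to the outflow telescope.

  The analytic one is that the eigenvector property determines the killed process. Let \<open>occ k y t\<close> be
  the probability of being at \<open>y\<close> at time \<open>t\<close> after \<open>k\<close> jumps inside \<open>E\<^sub>n\<close>. The cylinder probabilities yield
  the forward equation \<open>occ (k + 1) = step (occ k)\<close>, where \<open>step\<close> is a positive linear integral operator
  (\<open>occ_law\<close>, \<open>occ_Suc_step\<close>). The function \<open>target y t = exp (- J * t) * \<nu> y\<close> satisfies
  \<open>target = occ 0 + step target\<close>, so it exceeds the sum of \<open>occ i\<close> over \<open>i < k\<close> by the \<open>k\<close>-th iterate of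
  \<open>step\<close> on \<open>target\<close>. This remainder must vanish in the limit. Probabilistically, the remainder divided
  by \<open>target\<close> is the probability that the time-reversed process jumps at least \<open>k\<close> times before \<open>t\<close>, and the
  reversed process does not explode since its rates grow at most linearly in the number of clusters
  while each jump changes that number by at most one. In analytic terms, \<open>bound\<close> is a finite
  supersolution that dominates the sum of all iterates (\<open>sum_remainder_le_bound\<close>).

  Finally the event that the exit time exceeds \<open>t\<close> is the disjoint union, over \<open>k\<close> and \<open>y\<close>, of the events
  measured by \<open>occ k y t\<close> (\<open>before_exit_iff\<close>): a path that has exploded by time \<open>t\<close> has left \<open>E\<^sub>n\<close>, and
  any other path is in some sojourn interval.
\<close>

section \<open>Independent exponential holding times\<close>

definition exp_law :: "real \<Rightarrow> real measure" where
  "exp_law r = density lborel (exponential_density r)"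

text \<open>
  If \<open>G\<close> is the law of the arrival time at a state that is left at rate \<open>r\<close>, this is the
  probability of having arrived by time \<open>t\<close> and of still being there.
\<close>

definition still_waiting :: "real measure \<Rightarrow> real \<Rightarrow> real \<Rightarrow> ennreal" where
  "still_waiting G r t = (\<integral>\<^sup>+u. ennreal (exp (- r * (t - u))) * indicator {..t} u \<partial>G)"

lemma sets_exp_law [simp, measurable_cong]: "sets (exp_law r) = sets borel"
  by (simp add: exp_law_def)

lemma space_exp_law [simp]: "space (exp_law r) = UNIV"
  by (simp add: exp_law_def)

lemma prob_space_exp_law: "r > 0 \<Longrightarrow> prob_space (exp_law r)"
  unfolding exp_law_def by (rule prob_space_exponential_density)

lemma emeasure_exp_law_greaterThan:
  assumes "r > 0"
  shows "emeasure (exp_law r) {s<..} = ennreal (exp (- r * max 0 s))"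
proof -
  interpret prob_space "exp_law r" by (rule prob_space_exp_law) fact
  have "prob {..s} = erlang_CDF 0 r s"
    using emeasure_erlang_density[OF assms, of 0 s]
    by (simp add: exp_law_def measure_def erlang_CDF_nonneg assms)
  moreover have "{s<..} = space (exp_law r) - {..s}" by auto
  ultimately have "prob {s<..} = 1 - erlang_CDF 0 r s"
    using prob_compl[of "{..s}"] by simp
  then show ?thesis
    by (simp add: emeasure_eq_measure erlang_CDF_0 max_def)
qed

lemma emeasure_distr_on_event:
  assumes [measurable]: "Measurable.pred M D" "X \<in> measurable M N" "Z \<in> sets N"
  shows "emeasure (distr (density M (indicator {\<omega>\<in>space M. D \<omega>})) N X) Z =
    emeasure M {\<omega>\<in>space M. D \<omega> \<and> X \<omega> \<in> Z}"
proof -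
  have "emeasure (distr (density M (indicator {\<omega>\<in>space M. D \<omega>})) N X) Z =
      (\<integral>\<^sup>+\<omega>. indicator {\<omega>\<in>space M. D \<omega>} \<omega> * indicator (X -` Z \<inter> space M) \<omega> \<partial>M)"
    by (simp add: emeasure_distr emeasure_density)
  also have "\<dots> = (\<integral>\<^sup>+\<omega>. indicator {\<omega>\<in>space M. D \<omega> \<and> X \<omega> \<in> Z} \<omega> \<partial>M)"
    by (intro nn_integral_cong) (auto split: split_indicator)
  finally show ?thesis by simp
qed

text \<open>
  The hypothesis gives the joint law of \<open>U\<close> and \<open>V\<close> on the event \<open>D\<close> only on the sets
  \<open>A \<times> {s<..}\<close>. Half-lines determine the second marginal and rectangles determine the product, so
  on \<open>D\<close> the variable \<open>V\<close> is exponential and independent of \<open>U\<close>. The maximum makes the formula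
  meaningful for all real \<open>s\<close>, which is what the uniqueness theorem for half-lines asks for.
\<close>

lemma emeasure_joint_exponential:
  assumes [measurable]: "U \<in> borel_measurable M" "V \<in> borel_measurable M" "Measurable.pred M D"
    and G: "finite_measure G" "sets G = sets borel" and r: "r > 0"
    and eq: "\<And>A s. A \<in> sets borel \<Longrightarrow>
      emeasure M {\<omega>\<in>space M. D \<omega> \<and> U \<omega> \<in> A \<and> s < V \<omega>} = emeasure G A * ennreal (exp (- r * max 0 s))"
    and Z: "Z \<in> sets (borel \<Otimes>\<^sub>M borel)"
  shows "emeasure M {\<omega>\<in>space M. D \<omega> \<and> (U \<omega>, V \<omega>) \<in> Z} = emeasure (G \<Otimes>\<^sub>M exp_law r) Z"
proof -
  interpret G: finite_measure G by fact
  interpret E: prob_space "exp_law r" by (rule prob_space_exp_law) fact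
  note [measurable_cong] = G(2)
  define N where "N = distr (density M (indicator {\<omega>\<in>space M. D \<omega>})) (borel \<Otimes>\<^sub>M borel) (\<lambda>\<omega>. (U \<omega>, V \<omega>))"
  have N: "emeasure N Z = emeasure M {\<omega>\<in>space M. D \<omega> \<and> (U \<omega>, V \<omega>) \<in> Z}"
    if [measurable]: "Z \<in> sets (borel \<Otimes>\<^sub>M borel)" for Z
    unfolding N_def by (rule emeasure_distr_on_event) measurable
  have "G \<Otimes>\<^sub>M exp_law r = N"
  proof (rule pair_measure_eqI)
    show "sets (G \<Otimes>\<^sub>M exp_law r) = sets N"
      unfolding N_def sets_distr by (intro sets_pair_measure_cong G) simp
    fix A B assume "A \<in> sets G" "B \<in> sets (exp_law r)"
    then have [measurable]: "A \<in> sets borel" "B \<in> sets borel" using G by auto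
    define N1 where "N1 = distr (density M (indicator {\<omega>\<in>space M. D \<omega> \<and> U \<omega> \<in> A})) borel V"
    have N1: "emeasure N1 B = emeasure M {\<omega>\<in>space M. D \<omega> \<and> U \<omega> \<in> A \<and> V \<omega> \<in> B}"
      if [measurable]: "B \<in> sets borel" for B
      unfolding N1_def by (subst emeasure_distr_on_event) (auto simp: conj_assoc)
    have "N1 = scale_measure (emeasure G A) (exp_law r)"
    proof (rule measure_eqI_lessThan)
      fix x
      have *: "emeasure N1 {x<..} = emeasure G A * ennreal (exp (- r * max 0 x))"
        using eq[of A x] by (simp add: N1)
      show "emeasure N1 {x<..} = emeasure (scale_measure (emeasure G A) (exp_law r)) {x<..}"
        unfolding * by (simp add: emeasure_exp_law_greaterThan r)
      show "emeasure N1 {x<..} < \<infinity>" using G.emeasure_finite[of A]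
        unfolding * by (simp add: ennreal_mult_eq_top_iff less_top[symmetric])
    qed (simp_all add: N1_def)
    then have "emeasure N1 B = emeasure G A * emeasure (exp_law r) B" by simp
    then show "emeasure G A * emeasure (exp_law r) B = emeasure N (A \<times> B)"
      by (simp add: N N1 mem_Times_iff)
  qed unfold_locales
  with N[OF Z] show ?thesis by simp
qed

lemma still_waiting_measurable [measurable]:
  assumes "finite_measure G" "sets G = sets borel"
  shows "still_waiting G r \<in> borel_measurable borel"
proof -
  interpret finite_measure G by fact
  note [measurable_cong] = assms(2)
  have [measurable]: "(\<lambda>x. indicator {..fst x} (snd x) :: ennreal) \<in> borel_measurable (borel \<Otimes>\<^sub>M borel :: (real \<times> real) measure)"
    by (simp add: indicator_def)
  show ?thesis unfolding still_waiting_def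
    apply (rule borel_measurable_nn_integral)
    unfolding split_beta
    by (measurable)
qed

lemma sets_sum_mem: "B \<in> sets borel \<Longrightarrow> {(u, v). u + v \<in> B} \<in> sets (borel \<Otimes>\<^sub>M (borel :: real measure))"
proof -
  assume [measurable]: "B \<in> sets borel"
  have "{(u, v). u + v \<in> B} = {x\<in>space (borel \<Otimes>\<^sub>M borel). fst x + snd x \<in> B}"
    by (auto simp: space_pair_measure)
  also have "\<dots> \<in> sets (borel \<Otimes>\<^sub>M borel)" by measurable
  finally show ?thesis .
qed

lemma sets_last_arrival: "{(u, v). u \<le> t \<and> t < u + v} \<in> sets (borel \<Otimes>\<^sub>M (borel :: real measure))"
proof -
  have "{(u, v). u \<le> t \<and> t < u + v} = {x\<in>space (borel \<Otimes>\<^sub>M borel). fst x \<le> t \<and> t < fst x + snd x}"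
    by (auto simp: space_pair_measure)
  also have "\<dots> \<in> sets (borel \<Otimes>\<^sub>M borel)" by measurable
  finally show ?thesis .
qed

lemma emeasure_last_arrival:
  assumes G: "finite_measure G" "sets G = sets borel" and r: "r > 0"
  shows "emeasure (G \<Otimes>\<^sub>M exp_law r) {(u, v). u \<le> t \<and> t < u + v} = still_waiting G r t"
proof -
  interpret E: prob_space "exp_law r" by (rule prob_space_exp_law) fact
  note [measurable_cong] = assms(2)
  have "sets (borel \<Otimes>\<^sub>M borel) = sets (G \<Otimes>\<^sub>M exp_law r)"
    by (intro sets_pair_measure_cong) (simp_all add: G)
  from sets_last_arrival[of t, unfolded this]
  have [measurable]: "{(u, v). u \<le> t \<and> t < u + v} \<in> sets (G \<Otimes>\<^sub>M exp_law r)" .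
  show ?thesis
    unfolding still_waiting_def
  proof (subst E.emeasure_pair_measure_alt, measurable, intro nn_integral_cong)
    fix u
    show "emeasure (exp_law r) (Pair u -` {(u, v). u \<le> t \<and> t < u + v}) =
      ennreal (exp (- r * (t - u))) * indicator {..t} u"
    proof (cases "u \<le> t")
      case True
      then have "Pair u -` {(u, v). u \<le> t \<and> t < u + v} = {t - u<..}" by auto
      with True show ?thesis by (simp add: emeasure_exp_law_greaterThan r)
    qed simp
  qed
qed

text \<open>
  By Fubini, the sum of an arrival time and an independent exponential holding time has a density:
  the rate of leaving at time \<open>w\<close> is \<open>r\<close> times the probability of sitting in the state then.
\<close>

lemma emeasure_next_arrival:
  assumes G: "finite_measure G" "sets G = sets borel" and r: "r > 0" and [measurable]: "B \<in> sets borel"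
  shows "emeasure (G \<Otimes>\<^sub>M exp_law r) {(u, v). u + v \<in> B} =
    (\<integral>\<^sup>+w. ennreal r * still_waiting G r w * indicator B w \<partial>lborel)"
proof -
  interpret E: prob_space "exp_law r" by (rule prob_space_exp_law) fact
  interpret G: finite_measure G by fact
  interpret P: pair_sigma_finite G lborel ..
  note [measurable_cong] = assms(2)
  have "sets (borel \<Otimes>\<^sub>M borel) = sets (G \<Otimes>\<^sub>M exp_law r)"
    by (intro sets_pair_measure_cong) (simp_all add: G)
  from sets_sum_mem[OF \<open>B \<in> sets borel\<close>, unfolded this]
  have [measurable]: "{(u, v). u + v \<in> B} \<in> sets (G \<Otimes>\<^sub>M exp_law r)" .
  have "emeasure (G \<Otimes>\<^sub>M exp_law r) {(u, v). u + v \<in> B} =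
      (\<integral>\<^sup>+u. \<integral>\<^sup>+w. ennreal (exponential_density r (w - u)) * indicator B w \<partial>lborel \<partial>G)"
  proof (subst E.emeasure_pair_measure_alt, measurable, intro nn_integral_cong)
    fix u
    have [measurable]: "{v. u + v \<in> B} \<in> sets borel"
    proof -
      have "{v. u + v \<in> B} = {v\<in>space borel. u + v \<in> B}" by simp
      also have "\<dots> \<in> sets borel" by measurable
      finally show ?thesis .
    qed
    have "emeasure (exp_law r) (Pair u -` {(u, v). u + v \<in> B}) =
       (\<integral>\<^sup>+v. ennreal (exponential_density r v) * indicator {v. u + v \<in> B} v \<partial>lborel)"
      by (simp add: exp_law_def emeasure_density vimage_def)
    also have "\<dots> = (\<integral>\<^sup>+w. ennreal (exponential_density r (w - u)) * indicator {v. u + v \<in> B} (w - u) \<partial>lborel)"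
      by (subst nn_integral_real_affine[where c=1 and t="-u"]) auto
    finally show "emeasure (exp_law r) (Pair u -` {(u, v). u + v \<in> B}) =
       (\<integral>\<^sup>+w. ennreal (exponential_density r (w - u)) * indicator B w \<partial>lborel)"
      by (simp add: indicator_def)
  qed
  also have "\<dots> = (\<integral>\<^sup>+w. \<integral>\<^sup>+u. ennreal (exponential_density r (w - u)) * indicator B w \<partial>G \<partial>lborel)"
    by (subst P.Fubini') auto
  also have "\<dots> = (\<integral>\<^sup>+w. ennreal r * still_waiting G r w * indicator B w \<partial>lborel)"
  proof (intro nn_integral_cong)
    fix w
    have "(\<integral>\<^sup>+u. ennreal (exponential_density r (w - u)) * indicator B w \<partial>G) =
      (\<integral>\<^sup>+u. (ennreal r * (ennreal (exp (- r * (w - u))) * indicator {..w} u)) * indicator B w \<partial>G)"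
      using r by (intro nn_integral_cong)
        (auto simp: exponential_density_def ennreal_mult[symmetric] algebra_simps split: split_indicator)
    also have "\<dots> = ennreal r * still_waiting G r w * indicator B w"
      unfolding still_waiting_def by (simp add: nn_integral_multc nn_integral_cmult)
    finally show "(\<integral>\<^sup>+u. ennreal (exponential_density r (w - u)) * indicator B w \<partial>G) =
      ennreal r * still_waiting G r w * indicator B w" .
  qed
  finally show ?thesis .
qed

section \<open>The law of a jump chain with holding times up to the exit from a set\<close>

lemma emeasure_scale_pair_measure:
  assumes "sigma_finite_measure N" "Z \<in> sets (G \<Otimes>\<^sub>M N)"
  shows "emeasure (scale_measure c G \<Otimes>\<^sub>M N) Z = c * emeasure (G \<Otimes>\<^sub>M N) Z"
proof -
  interpret sigma_finite_measure N by fact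
  have [simp]: "sets (scale_measure c G \<Otimes>\<^sub>M N) = sets (G \<Otimes>\<^sub>M N)"
    by (intro sets_pair_measure_cong) auto
  show ?thesis using assms(2)
    by (simp add: emeasure_pair_measure_alt nn_integral_scale_measure measurable_emeasure_Pair)
qed

text \<open>
  A countable sum of measurable functions, written as an integral so that no enumeration of the
  index set has to be chosen.
\<close>

lemma borel_measurable_nn_integral_count_space:
  assumes "countable F" "\<And>x. x \<in> F \<Longrightarrow> h x \<in> borel_measurable N"
  shows "(\<lambda>w. \<integral>\<^sup>+x. h x w \<partial>count_space F) \<in> borel_measurable N"
proof -
  interpret sigma_finite_measure "count_space F"
    using assms(1) by (rule sigma_finite_measure_count_space_countable)
  have *: "(\<lambda>(x, w). h x w) \<in> borel_measurable (count_space F \<Otimes>\<^sub>M N)"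
    using assms by (intro measurable_pair_measure_countable1) auto
  show ?thesis
    using measurable_pair_swap[OF *] by (intro borel_measurable_nn_integral) (simp add: split_beta')
qed

text \<open>
  A jump chain \<open>Y\<close> with holding times \<open>S\<close>, prescribed by its cylinder probabilities. The set \<open>F\<close> is
  where the process is to be kept. Before an explosion every instant lies in the sojourn interval of
  some \<open>Y k\<close>, so the pairs of \<open>Y k\<close> and \<open>S k\<close> carry all information about the time up to the exit.
\<close>

locale jump_hold_process = prob_space M for M :: "'w measure" +
  fixes Y :: "nat \<Rightarrow> 'w \<Rightarrow> 's" and S :: "nat \<Rightarrow> 'w \<Rightarrow> real"
    and E F :: "'s set" and \<mu> q :: "'s \<Rightarrow> real" and \<pi> :: "'s \<Rightarrow> 's \<Rightarrow> real"
  assumes countable_E: "countable E"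
    and F_subset: "F \<subseteq> E"
    and Y_measurable [measurable]: "\<And>k. Y k \<in> measurable M (count_space E)"
    and S_measurable [measurable]: "\<And>k. S k \<in> borel_measurable M"
    and S_pos: "\<And>k \<omega>. \<omega> \<in> space M \<Longrightarrow> 0 < S k \<omega>"
    and \<mu>_nonneg: "\<And>x. x \<in> E \<Longrightarrow> 0 \<le> \<mu> x"
    and q_pos: "\<And>x. x \<in> E \<Longrightarrow> 0 < q x"
    and \<pi>_nonneg: "\<And>x y. x \<in> E \<Longrightarrow> y \<in> E \<Longrightarrow> 0 \<le> \<pi> x y"
    and cylinder: "\<And>k x s. (\<And>i. i \<le> k \<Longrightarrow> x i \<in> E \<and> 0 \<le> s i) \<Longrightarrow>
      prob {\<omega>\<in>space M. \<forall>i\<le>k. Y i \<omega> = x i \<and> s i < S i \<omega>} =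
        \<mu> (x 0) * (\<Prod>i<k. \<pi> (x i) (x (Suc i))) * (\<Prod>i\<le>k. exp (- q (x i) * s i))"
begin

text \<open>
  \<open>arrival k x\<close> is the law of the \<open>k\<close>-th jump time on the event that the chain sits at \<open>x\<close> after \<open>k\<close>
  jumps and was in \<open>F\<close> before; its total mass is the probability of that event. The density in the
  successor case is the rate at which mass that is still in \<open>F\<close> after \<open>k\<close> jumps flows into \<open>y\<close>.
\<close>

primrec arrival :: "nat \<Rightarrow> 's \<Rightarrow> real measure" where
  "arrival 0 = (\<lambda>x. scale_measure (ennreal (\<mu> x)) (return borel 0))"
| "arrival (Suc k) = (\<lambda>y. density lborel (\<lambda>w.
     \<integral>\<^sup>+x. ennreal (\<pi> x y * q x) * still_waiting (arrival k x) (q x) w \<partial>count_space F))"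

text \<open>
  The probability of being at \<open>x\<close> at a given time after exactly \<open>k\<close> jumps, all spent in \<open>F\<close>.
\<close>

definition occ :: "nat \<Rightarrow> 's \<Rightarrow> real \<Rightarrow> ennreal" where
  "occ k x = still_waiting (arrival k x) (q x)"

abbreviation jump_time :: "nat \<Rightarrow> 'w \<Rightarrow> real" where
  "jump_time k \<omega> \<equiv> (\<Sum>i<k. S i \<omega>)"

lemma countable_F: "countable F"
  using F_subset countable_E by (rule countable_subset)

lemma sets_arrival [simp]: "sets (arrival k x) = sets borel"
  by (cases k) auto

lemma pred_Y_eq [measurable]: "Measurable.pred M (\<lambda>\<omega>. Y k \<omega> = x)"
proof (cases "x \<in> E")
  case True
  then show ?thesis
    using measurable_sets[OF Y_measurable[of k], of "{x}"]
    by (simp add: pred_def vimage_def Int_def conj_commute)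
next
  case False
  then have "Measurable.pred M (\<lambda>\<omega>. Y k \<omega> = x) \<longleftrightarrow> Measurable.pred M (\<lambda>\<omega>. False)"
    using measurable_space[OF Y_measurable[of k]] by (intro measurable_cong) auto
  then show ?thesis by simp
qed

lemma pred_Y_mem [measurable]: "Measurable.pred M (\<lambda>\<omega>. Y k \<omega> \<in> F)"
  using measurable_sets[OF Y_measurable[of k], of F] F_subset
  by (simp add: pred_def vimage_def Int_def conj_commute)

abbreviation path_weight :: "nat \<Rightarrow> nat \<Rightarrow> nat \<Rightarrow> (nat \<Rightarrow> 's) \<Rightarrow> (nat \<Rightarrow> real) \<Rightarrow> real" where
  "path_weight k l m p s \<equiv>
     (\<Prod>i=k..<m. \<pi> (p i) (p (Suc i))) * (\<Prod>i=l..m. exp (- q (p i) * max 0 (s i)))"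

lemma path_weight_nonneg: "(\<And>i. i \<in> {k..m} \<Longrightarrow> p i \<in> E) \<Longrightarrow> 0 \<le> path_weight k l m p s"
  by (auto intro!: mult_nonneg_nonneg prod_nonneg \<pi>_nonneg)

text \<open>
  The induction over the number of jumps needs the future holding times in the statement: the
  cylinder formula separates all coordinates, and each induction step absorbs one more of them into
  the jump time while the later ones remain separate.
\<close>

definition arrival_law_at :: "nat \<Rightarrow> bool" where
  "arrival_law_at k \<longleftrightarrow> (\<forall>m p s B. k \<le> m \<longrightarrow> (\<forall>i\<in>{k..m}. p i \<in> E) \<longrightarrow> B \<in> sets borel \<longrightarrow>
     emeasure M {\<omega>\<in>space M. (\<forall>i<k. Y i \<omega> \<in> F) \<and> (\<forall>i\<in>{k..m}. Y i \<omega> = p i \<and> s i < S i \<omega>) \<and>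
        jump_time k \<omega> \<in> B} =
     emeasure (arrival k (p k)) B * ennreal (path_weight k k m p s))"

lemma arrival_law_atD:
  assumes "arrival_law_at k" "k \<le> m" "\<And>i. i \<in> {k..m} \<Longrightarrow> p i \<in> E" "B \<in> sets borel"
  shows "emeasure M {\<omega>\<in>space M. (\<forall>i<k. Y i \<omega> \<in> F) \<and> (\<forall>i\<in>{k..m}. Y i \<omega> = p i \<and> s i < S i \<omega>) \<and>
        jump_time k \<omega> \<in> B} =
     emeasure (arrival k (p k)) B * ennreal (path_weight k k m p s)"
  using assms unfolding arrival_law_at_def by blast

lemma finite_measure_arrival:
  assumes "arrival_law_at k" "x \<in> E"
  shows "finite_measure (arrival k x)"
proof
  have "emeasure (arrival k x) UNIV =
     emeasure M {\<omega>\<in>space M. (\<forall>i<k. Y i \<omega> \<in> F) \<and> (\<forall>i\<in>{k..k}. Y i \<omega> = x \<and> 0 < S i \<omega>) \<and>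
        jump_time k \<omega> \<in> UNIV}"
    using assms by (subst arrival_law_atD) auto
  also have "\<dots> \<le> 1" by (rule emeasure_le_1)
  finally have "emeasure (arrival k x) UNIV \<noteq> \<infinity>" by (auto simp: top_unique)
  moreover have "space (arrival k x) = UNIV"
    using sets_eq_imp_space_eq[OF sets_arrival] by simp
  ultimately show "emeasure (arrival k x) (space (arrival k x)) \<noteq> \<infinity>" by simp
qed

text \<open>
  The coordinate \<open>s k\<close> in the law at \<open>k\<close> is free, hence on the event in question the holding time
  \<open>S k\<close> is exponential and independent of the jump time before it.
\<close>

lemma arrival_joint:
  assumes k: "arrival_law_at k" "k \<le> m" and p: "\<And>i. i \<in> {k..m} \<Longrightarrow> p i \<in> E"
    and Z: "Z \<in> sets (borel \<Otimes>\<^sub>M borel)"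
  shows "emeasure M {\<omega>\<in>space M. ((\<forall>i<k. Y i \<omega> \<in> F) \<and> Y k \<omega> = p k \<and>
      (\<forall>i\<in>{Suc k..m}. Y i \<omega> = p i \<and> s i < S i \<omega>)) \<and> (jump_time k \<omega>, S k \<omega>) \<in> Z} =
    ennreal (path_weight k (Suc k) m p s) * emeasure (arrival k (p k) \<Otimes>\<^sub>M exp_law (q (p k))) Z"
proof -
  let ?c = "ennreal (path_weight k (Suc k) m p s)"
  have pk: "p k \<in> E" using p k by auto
  interpret G: finite_measure "arrival k (p k)" by (rule finite_measure_arrival) fact+
  interpret X: prob_space "exp_law (q (p k))" by (rule prob_space_exp_law) (rule q_pos, fact)
  have "emeasure M {\<omega>\<in>space M. ((\<forall>i<k. Y i \<omega> \<in> F) \<and> Y k \<omega> = p k \<and>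
      (\<forall>i\<in>{Suc k..m}. Y i \<omega> = p i \<and> s i < S i \<omega>)) \<and> (jump_time k \<omega>, S k \<omega>) \<in> Z} =
    emeasure (scale_measure ?c (arrival k (p k)) \<Otimes>\<^sub>M exp_law (q (p k))) Z"
  proof (rule emeasure_joint_exponential)
    show "finite_measure (scale_measure ?c (arrival k (p k)))"
      by (rule finite_measureI) (simp add: ennreal_mult_eq_top_iff)
    show "0 < q (p k)" using pk by (rule q_pos)
    fix A :: "real set" and r assume A: "A \<in> sets borel"
    let ?s = "s(k := r)"
    have split: "{k..m} = insert k {Suc k..m}" using k by auto
    have "{\<omega>\<in>space M. ((\<forall>i<k. Y i \<omega> \<in> F) \<and> Y k \<omega> = p k \<and>
      (\<forall>i\<in>{Suc k..m}. Y i \<omega> = p i \<and> s i < S i \<omega>)) \<and> jump_time k \<omega> \<in> A \<and> r < S k \<omega>} =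
      {\<omega>\<in>space M. (\<forall>i<k. Y i \<omega> \<in> F) \<and> (\<forall>i\<in>{k..m}. Y i \<omega> = p i \<and> ?s i < S i \<omega>) \<and>
        jump_time k \<omega> \<in> A}"
      unfolding split by auto
    also have "emeasure M \<dots> = emeasure (arrival k (p k)) A * ennreal (path_weight k k m p ?s)"
      using k p A by (rule arrival_law_atD)
    also have "path_weight k k m p ?s = path_weight k (Suc k) m p s * exp (- q (p k) * max 0 r)"
      unfolding split by (simp add: mult_ac)
    also have "emeasure (arrival k (p k)) A * ennreal (path_weight k (Suc k) m p s * exp (- q (p k) * max 0 r)) =
       emeasure (scale_measure ?c (arrival k (p k))) A * ennreal (exp (- q (p k) * max 0 r))"
      using path_weight_nonneg[where k=k and m=m and p=p and l="Suc k" and s=s] p by (simp add: ennreal_mult mult_ac)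
    finally show "emeasure M {\<omega>\<in>space M. ((\<forall>i<k. Y i \<omega> \<in> F) \<and> Y k \<omega> = p k \<and>
      (\<forall>i\<in>{Suc k..m}. Y i \<omega> = p i \<and> s i < S i \<omega>)) \<and> jump_time k \<omega> \<in> A \<and> r < S k \<omega>} =
       emeasure (scale_measure ?c (arrival k (p k))) A * ennreal (exp (- q (p k) * max 0 r))" .
  qed (use Z in \<open>simp_all\<close>)
  also have "\<dots> = ?c * emeasure (arrival k (p k) \<Otimes>\<^sub>M exp_law (q (p k))) Z"
  proof (rule emeasure_scale_pair_measure)
    have eq: "sets (borel \<Otimes>\<^sub>M borel) = sets (arrival k (p k) \<Otimes>\<^sub>M exp_law (q (p k)))"
      by (intro sets_pair_measure_cong) simp_all
    show "Z \<in> sets (arrival k (p k) \<Otimes>\<^sub>M exp_law (q (p k)))" using Z unfolding eq .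
  qed unfold_locales
  finally show ?thesis .
qed

lemma arrival_law_at_0: "arrival_law_at 0"
  unfolding arrival_law_at_def
proof (intro allI impI)
  fix m :: nat and p :: "nat \<Rightarrow> 's" and s :: "nat \<Rightarrow> real" and B :: "real set" assume p: "\<forall>i\<in>{0..m}. p i \<in> E" and B: "B \<in> sets borel"
  \<comment> \<open>Holding times are positive, so negative thresholds may be replaced by zero.\<close>
  have "{\<omega>\<in>space M. (\<forall>i<0. Y i \<omega> \<in> F) \<and> (\<forall>i\<in>{0..m}. Y i \<omega> = p i \<and> s i < S i \<omega>) \<and>
        jump_time 0 \<omega> \<in> B} =
     (if 0 \<in> B then {\<omega>\<in>space M. \<forall>i\<le>m. Y i \<omega> = p i \<and> max 0 (s i) < S i \<omega>} else {})"
    using S_pos by auto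
  also have "emeasure M \<dots> = indicator B 0 * ennreal (\<mu> (p 0) * path_weight 0 0 m p s)"
    using p cylinder[of m p "\<lambda>i. max 0 (s i)"]
    by (auto simp: emeasure_eq_measure atLeast0LessThan atLeast0AtMost mult_ac)
  also have "\<dots> = emeasure (arrival 0 (p 0)) B * ennreal (path_weight 0 0 m p s)"
    using B p \<mu>_nonneg[of "p 0"] path_weight_nonneg[where k=0 and m=m and p=p and l=0 and s=s]
    by (simp add: ennreal_mult mult_ac)
  finally show "emeasure M {\<omega>\<in>space M. (\<forall>i<0. Y i \<omega> \<in> F) \<and> (\<forall>i\<in>{0..m}. Y i \<omega> = p i \<and> s i < S i \<omega>) \<and>
        jump_time 0 \<omega> \<in> B} = emeasure (arrival 0 (p 0)) B * ennreal (path_weight 0 0 m p s)" .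
qed

lemma arrival_density_measurable:
  assumes "arrival_law_at k"
  shows "(\<lambda>w. \<integral>\<^sup>+x. ennreal (\<pi> x y * q x) * still_waiting (arrival k x) (q x) w \<partial>count_space F)
    \<in> borel_measurable borel"
proof (rule borel_measurable_nn_integral_count_space[OF countable_F])
  fix x assume "x \<in> F"
  then have "still_waiting (arrival k x) (q x) \<in> borel_measurable borel"
    using F_subset by (intro still_waiting_measurable finite_measure_arrival assms) auto
  then show "(\<lambda>w. ennreal (\<pi> x y * q x) * still_waiting (arrival k x) (q x) w) \<in> borel_measurable borel"
    by simp
qed

text \<open>
  The states visited after \<open>k\<close> jumps split the event into countably many pieces. On each piece the
  new jump time is the sum of the independent pair in \<open>arrival_joint\<close>, and its density adds up to
  that of \<open>arrival (Suc k)\<close>.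
\<close>

lemma arrival_law_at_Suc:
  assumes "arrival_law_at k"
  shows "arrival_law_at (Suc k)"
  unfolding arrival_law_at_def
proof (intro allI impI)
  fix m :: nat and p :: "nat \<Rightarrow> 's" and s :: "nat \<Rightarrow> real" and B :: "real set"
  assume m: "Suc k \<le> m" and p: "\<forall>i\<in>{Suc k..m}. p i \<in> E" and B[measurable]: "B \<in> sets borel"
  let ?y = "p (Suc k)" and ?w = "path_weight (Suc k) (Suc k) m p s"
  define D where "D x = {\<omega>\<in>space M. ((\<forall>i<k. Y i \<omega> \<in> F) \<and> Y k \<omega> = x \<and>
      (\<forall>i\<in>{Suc k..m}. Y i \<omega> = p i \<and> s i < S i \<omega>)) \<and> (jump_time k \<omega>, S k \<omega>) \<in> {(u, v). u + v \<in> B}}" for x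
  have [measurable]: "D x \<in> sets M" for x
    unfolding D_def prod.case mem_Collect_eq by measurable
  have y: "?y \<in> E" using p m by auto
  have w: "0 \<le> ?w" using p by (intro path_weight_nonneg) auto
  have "{\<omega>\<in>space M. (\<forall>i<Suc k. Y i \<omega> \<in> F) \<and> (\<forall>i\<in>{Suc k..m}. Y i \<omega> = p i \<and> s i < S i \<omega>) \<and>
        jump_time (Suc k) \<omega> \<in> B} = (\<Union>x\<in>F. D x)"
    by (auto simp: D_def less_Suc_eq)
  also have "emeasure M \<dots> = (\<integral>\<^sup>+x. emeasure M (D x) \<partial>count_space F)"
    by (rule emeasure_UN_countable) (auto simp: countable_F disjoint_family_on_def D_def)
  also have "\<dots> = (\<integral>\<^sup>+x. ennreal ?w * (\<integral>\<^sup>+w. ennreal (\<pi> x ?y * q x) * still_waiting (arrival k x) (q x) w * indicator B w \<partial>lborel) \<partial>count_space F)"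
  proof (rule nn_integral_cong)
    fix x assume "x \<in> space (count_space F)"
    then have x: "x \<in> E" using F_subset by auto
    let ?p = "p(k := x)"
    have pE: "?p i \<in> E" if "i \<in> {k..m}" for i using that p x by (cases "i = k") auto
    have *: "{k..<m} = insert k {Suc k..<m}" using m by auto
    have pw: "path_weight k (Suc k) m ?p s = \<pi> x ?y * ?w"
      unfolding * using m by (simp add: mult_ac)
    have [measurable]: "still_waiting (arrival k x) (q x) \<in> borel_measurable borel"
      using x by (intro still_waiting_measurable finite_measure_arrival assms) auto
    have "emeasure M (D x) = ennreal (path_weight k (Suc k) m ?p s) *
       emeasure (arrival k (?p k) \<Otimes>\<^sub>M exp_law (q (?p k))) {(u, v). u + v \<in> B}"
      using arrival_joint[where k=k and m=m and p="?p" and s=s, OF assms _ pE sets_sum_mem[OF B]] m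
      unfolding D_def by simp
    also have "\<dots> = ennreal ?w * (ennreal (\<pi> x ?y) * (\<integral>\<^sup>+w. ennreal (q x) * still_waiting (arrival k x) (q x) w * indicator B w \<partial>lborel))"
      unfolding pw using x y w \<pi>_nonneg[of x ?y]
      by (simp add: emeasure_next_arrival finite_measure_arrival assms q_pos ennreal_mult mult_ac)
    also have "ennreal (\<pi> x ?y) * (\<integral>\<^sup>+w. ennreal (q x) * still_waiting (arrival k x) (q x) w * indicator B w \<partial>lborel) =
       (\<integral>\<^sup>+w. ennreal (\<pi> x ?y * q x) * still_waiting (arrival k x) (q x) w * indicator B w \<partial>lborel)"
      using x y \<pi>_nonneg[of x ?y] q_pos[of x]
      by (subst nn_integral_cmult[symmetric]) (auto simp: ennreal_mult mult_ac)
    finally show "emeasure M (D x) = ennreal ?w * (\<integral>\<^sup>+w. ennreal (\<pi> x ?y * q x) * still_waiting (arrival k x) (q x) w * indicator B w \<partial>lborel)" .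
  qed
  also have "\<dots> = ennreal ?w * (\<integral>\<^sup>+x. \<integral>\<^sup>+w. ennreal (\<pi> x ?y * q x) * still_waiting (arrival k x) (q x) w * indicator B w \<partial>lborel \<partial>count_space F)"
    by (simp add: nn_integral_cmult)
  also have "(\<integral>\<^sup>+x. \<integral>\<^sup>+w. ennreal (\<pi> x ?y * q x) * still_waiting (arrival k x) (q x) w * indicator B w \<partial>lborel \<partial>count_space F) =
      (\<integral>\<^sup>+w. \<integral>\<^sup>+x. ennreal (\<pi> x ?y * q x) * still_waiting (arrival k x) (q x) w * indicator B w \<partial>count_space F \<partial>lborel)"
  proof (rule nn_integral_count_space_nn_integral[OF countable_F, symmetric])
    fix x assume "x \<in> F"
    then have [measurable]: "still_waiting (arrival k x) (q x) \<in> borel_measurable borel"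
      using F_subset by (intro still_waiting_measurable finite_measure_arrival assms) auto
    show "(\<lambda>w. ennreal (\<pi> x ?y * q x) * still_waiting (arrival k x) (q x) w * indicator B w) \<in> borel_measurable lborel"
      by measurable
  qed
  also have "\<dots> = emeasure (arrival (Suc k) ?y) B"
    using arrival_density_measurable[OF assms, of ?y]
    by (simp add: emeasure_density nn_integral_multc)
  finally show "emeasure M {\<omega>\<in>space M. (\<forall>i<Suc k. Y i \<omega> \<in> F) \<and> (\<forall>i\<in>{Suc k..m}. Y i \<omega> = p i \<and> s i < S i \<omega>) \<and>
        jump_time (Suc k) \<omega> \<in> B} = emeasure (arrival (Suc k) ?y) B * ennreal ?w"
    by (simp add: mult.commute)
qed

lemma arrival_law: "arrival_law_at k"
  by (induction k) (auto intro: arrival_law_at_0 arrival_law_at_Suc)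

lemma occ_measurable: "x \<in> E \<Longrightarrow> occ k x \<in> borel_measurable borel"
  unfolding occ_def by (intro still_waiting_measurable finite_measure_arrival arrival_law) auto

lemma occ_law:
  assumes "y \<in> F"
  shows "emeasure M {\<omega>\<in>space M. (\<forall>i\<le>k. Y i \<omega> \<in> F) \<and> Y k \<omega> = y \<and> jump_time k \<omega> \<le> t \<and> t < jump_time (Suc k) \<omega>} =
    occ k y t"
proof -
  have "{\<omega>\<in>space M. (\<forall>i\<le>k. Y i \<omega> \<in> F) \<and> Y k \<omega> = y \<and> jump_time k \<omega> \<le> t \<and> t < jump_time (Suc k) \<omega>} =
    {\<omega>\<in>space M. ((\<forall>i<k. Y i \<omega> \<in> F) \<and> Y k \<omega> = y \<and>
      (\<forall>i\<in>{Suc k..k}. Y i \<omega> = y \<and> 0 < S i \<omega>)) \<and> (jump_time k \<omega>, S k \<omega>) \<in> {(u, v). u \<le> t \<and> t < u + v}}"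
    using assms by (auto simp: le_less)
  also have "emeasure M \<dots> = emeasure (arrival k y \<Otimes>\<^sub>M exp_law (q y)) {(u, v). u \<le> t \<and> t < u + v}"
    using arrival_joint[OF arrival_law, of k k "\<lambda>_. y" "{(u, v). u \<le> t \<and> t < u + v}" "\<lambda>_. 0"] assms F_subset
      sets_last_arrival[of t]
    by auto
  also have "\<dots> = occ k y t"
    unfolding occ_def using assms F_subset
    by (intro emeasure_last_arrival finite_measure_arrival arrival_law q_pos) auto
  finally show ?thesis .
qed

lemma occ_0: "x \<in> E \<Longrightarrow> occ 0 x t = ennreal (\<mu> x * exp (- q x * t)) * indicator {0..} t"
  using \<mu>_nonneg[of x]
  by (simp add: occ_def still_waiting_def nn_integral_scale_measure nn_integral_return ennreal_mult split: split_indicator)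

text \<open>
  The forward equation of the process killed outside \<open>F\<close>, resolved by the number of jumps.
\<close>

lemma occ_Suc:
  "occ (Suc k) y t = (\<integral>\<^sup>+s. ennreal (exp (- q y * (t - s))) * indicator {..t} s *
     (\<integral>\<^sup>+x. ennreal (\<pi> x y * q x) * occ k x s \<partial>count_space F) \<partial>lborel)"
  unfolding occ_def using arrival_density_measurable[OF arrival_law[of k], of y]
  by (subst still_waiting_def) (simp add: nn_integral_density mult_ac)

end

section \<open>Quasi-stationary solutions of the forward equation\<close>

text \<open>
  The factor \<open>r + l\<close> stays on the left so that the case \<open>r + l = 0\<close> is covered.
\<close>

lemma nn_integral_exp_convolution:
  fixes r l t :: real
  assumes "0 \<le> r + l" "0 \<le> t"
  shows "ennreal (r + l) * (\<integral>\<^sup>+s. ennreal (exp (- r * (t - s)) * exp (l * s)) * indicator {0..t} s \<partial>lborel) =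
    ennreal (exp (l * t) - exp (- r * t))"
proof -
  have "ennreal (r + l) * (\<integral>\<^sup>+s. ennreal (exp (- r * (t - s)) * exp (l * s)) * indicator {0..t} s \<partial>lborel) =
    (\<integral>\<^sup>+s. ennreal ((r + l) * (exp (- r * (t - s)) * exp (l * s))) * indicator {0..t} s \<partial>lborel)"
    using assms by (subst nn_integral_cmult[symmetric]) (auto simp: ennreal_mult mult_ac)
  also have "\<dots> = ennreal (exp (- r * (t - t)) * exp (l * t) - exp (- r * (t - 0)) * exp (l * 0))"
  proof (rule nn_integral_FTC_Icc)
    fix s
    show "((\<lambda>s. exp (- r * (t - s)) * exp (l * s)) has_real_derivative
      (r + l) * (exp (- r * (t - s)) * exp (l * s))) (at s)"
      by (auto intro!: derivative_eq_intros simp: algebra_simps)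
    show "0 \<le> (r + l) * (exp (- r * (t - s)) * exp (l * s))"
      using assms by simp
  qed (use assms in \<open>auto intro!: borel_measurable_times borel_measurable_continuous_onI continuous_intros\<close>)
  finally show ?thesis by simp
qed

context jump_hold_process
begin

text \<open>
  The integral operator of the forward equation: the mass \<open>h\<close> makes one more jump, inside \<open>F\<close>, and
  then waits.
\<close>

definition step :: "('s \<Rightarrow> real \<Rightarrow> ennreal) \<Rightarrow> 's \<Rightarrow> real \<Rightarrow> ennreal" where
  "step h y t = (\<integral>\<^sup>+s. ennreal (exp (- q y * (t - s))) * indicator {..t} s *
     (\<integral>\<^sup>+x. ennreal (\<pi> x y * q x) * h x s \<partial>count_space F) \<partial>lborel)"

lemma occ_Suc_step: "occ (Suc k) y t = step (occ k) y t"
  unfolding step_def by (rule occ_Suc)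

lemma step_mono:
  assumes "\<And>x s. x \<in> F \<Longrightarrow> h x s \<le> h' x s"
  shows "step h y t \<le> step h' y t"
  unfolding step_def using assms by (intro nn_integral_mono mult_left_mono) auto

lemma step_cong:
  assumes "\<And>x s. x \<in> F \<Longrightarrow> h x s = h' x s"
  shows "step h y t = step h' y t"
  using assms by (intro antisym step_mono) auto

lemma inflow_measurable:
  assumes "\<And>x. x \<in> F \<Longrightarrow> h x \<in> borel_measurable borel"
  shows "(\<lambda>s. \<integral>\<^sup>+x. ennreal (\<pi> x y * q x) * h x s \<partial>count_space F) \<in> borel_measurable borel"
  using assms by (intro borel_measurable_nn_integral_count_space countable_F) auto

lemma step_measurable:
  assumes "\<And>x. x \<in> F \<Longrightarrow> h x \<in> borel_measurable borel"
  shows "step h y \<in> borel_measurable borel"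
proof -
  note [measurable] = inflow_measurable[where h=h, OF assms, of y, simplified]
  have [measurable]: "(\<lambda>x. indicator {..fst x} (snd x) :: ennreal) \<in> borel_measurable (borel \<Otimes>\<^sub>M borel :: (real \<times> real) measure)"
    by (simp add: indicator_def)
  show ?thesis
    unfolding step_def
    apply (rule lborel.borel_measurable_nn_integral)
    unfolding split_beta
    by measurable
qed

lemma step_add:
  assumes "\<And>x. x \<in> F \<Longrightarrow> h x \<in> borel_measurable borel" "\<And>x. x \<in> F \<Longrightarrow> h' x \<in> borel_measurable borel"
  shows "step (\<lambda>x s. h x s + h' x s) y t = step h y t + step h' y t"
  unfolding step_def
  using inflow_measurable[where h=h, OF assms(1), of y] inflow_measurable[where h=h', OF assms(2), of y]
  by (simp add: distrib_left nn_integral_add)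

lemma step_sum:
  assumes "\<And>x i. x \<in> F \<Longrightarrow> h i x \<in> borel_measurable borel"
  shows "step (\<lambda>x s. \<Sum>i<k. h i x s) y t = (\<Sum>i<(k::nat). step (h i) y t)"
proof (induction k)
  case 0
  show ?case by (simp add: step_def)
next
  case (Suc k)
  then show ?case using assms by (simp add: step_add)
qed

lemma step_exponential:
  assumes c: "\<And>x. x \<in> F \<Longrightarrow> 0 \<le> c x" and t: "0 \<le> t"
  shows "step (\<lambda>x s. ennreal (c x * exp (l * s)) * indicator {0..} s) y t =
    (\<integral>\<^sup>+x. ennreal (c x) * ennreal (\<pi> x y * q x) \<partial>count_space F) *
    (\<integral>\<^sup>+s. ennreal (exp (- q y * (t - s)) * exp (l * s)) * indicator {0..t} s \<partial>lborel)"
proof -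
  have "step (\<lambda>x s. ennreal (c x * exp (l * s)) * indicator {0..} s) y t =
    (\<integral>\<^sup>+s. (\<integral>\<^sup>+x. ennreal (c x) * ennreal (\<pi> x y * q x) \<partial>count_space F) *
      (ennreal (exp (- q y * (t - s)) * exp (l * s)) * indicator {0..t} s) \<partial>lborel)"
    unfolding step_def
  proof (rule nn_integral_cong)
    fix s
    have "(\<integral>\<^sup>+x. ennreal (\<pi> x y * q x) * (ennreal (c x * exp (l * s)) * indicator {0..} s) \<partial>count_space F) =
      (\<integral>\<^sup>+x. ennreal (c x) * ennreal (\<pi> x y * q x) * (ennreal (exp (l * s)) * indicator {0..} s) \<partial>count_space F)"
      using c by (intro nn_integral_cong) (auto simp: ennreal_mult mult_ac)
    also have "\<dots> = (\<integral>\<^sup>+x. ennreal (c x) * ennreal (\<pi> x y * q x) \<partial>count_space F) * (ennreal (exp (l * s)) * indicator {0..} s)"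
      by (rule nn_integral_multc) simp
    finally show "ennreal (exp (- q y * (t - s))) * indicator {..t} s *
       (\<integral>\<^sup>+x. ennreal (\<pi> x y * q x) * (ennreal (c x * exp (l * s)) * indicator {0..} s) \<partial>count_space F) =
       (\<integral>\<^sup>+x. ennreal (c x) * ennreal (\<pi> x y * q x) \<partial>count_space F) *
      (ennreal (exp (- q y * (t - s)) * exp (l * s)) * indicator {0..t} s)"
      by (auto simp: ennreal_mult mult_ac split: split_indicator)
  qed
  also have "\<dots> = (\<integral>\<^sup>+x. ennreal (c x) * ennreal (\<pi> x y * q x) \<partial>count_space F) *
    (\<integral>\<^sup>+s. ennreal (exp (- q y * (t - s)) * exp (l * s)) * indicator {0..t} s \<partial>lborel)"
    by (rule nn_integral_cmult) simp
  finally show ?thesis .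
qed

lemma step_at_negative_time:
  assumes "t < 0" "\<And>x s. x \<in> F \<Longrightarrow> s < 0 \<Longrightarrow> h x s = 0"
  shows "step h y t = 0"
proof -
  have "step h y t = (\<integral>\<^sup>+s. 0 \<partial>(lborel :: real measure))"
    unfolding step_def
  proof (rule nn_integral_cong)
    fix s :: real
    show "ennreal (exp (- q y * (t - s))) * indicator {..t} s *
      (\<integral>\<^sup>+x. ennreal (\<pi> x y * q x) * h x s \<partial>count_space F) = 0"
    proof (cases "s \<le> t")
      case True
      then have "(\<integral>\<^sup>+x. ennreal (\<pi> x y * q x) * h x s \<partial>count_space F) = (\<integral>\<^sup>+x. 0 \<partial>count_space F)"
        using assms by (intro nn_integral_cong) auto
      then show ?thesis by simp
    qed simp
  qed
  then show ?thesis by simp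
qed

end

text \<open>
  The initial law \<open>\<mu>\<close> is a left eigenvector, with eigenvalue \<open>- J\<close>, of the generator restricted to
  \<open>F\<close>; that is \<open>balance\<close>. The function \<open>V\<close> controls the rates linearly and grows by at most one along
  each reversed jump, which keeps the time reversal of the killed process from exploding.
\<close>

locale quasi_stationary_jump_hold_process = jump_hold_process M Y S E F \<mu> q \<pi>
  for M :: "'w measure" and Y :: "nat \<Rightarrow> 'w \<Rightarrow> 's" and S E F \<mu> q \<pi> +
  fixes J K :: real and V :: "'s \<Rightarrow> real"
  assumes balance: "\<And>y. y \<in> F \<Longrightarrow>
      (\<integral>\<^sup>+x. ennreal (\<mu> x) * ennreal (\<pi> x y * q x) \<partial>count_space F) = ennreal (\<mu> y * (q y - J))"
    and J_nonneg: "0 \<le> J"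
    and J_le_q: "\<And>y. y \<in> F \<Longrightarrow> J \<le> q y"
    and V_nonneg: "\<And>x. x \<in> F \<Longrightarrow> 0 \<le> V x"
    and V_step: "\<And>x y. x \<in> F \<Longrightarrow> y \<in> F \<Longrightarrow> \<pi> x y > 0 \<Longrightarrow> V x \<le> V y + 1"
    and q_growth: "\<And>y. y \<in> F \<Longrightarrow> q y \<le> K * (1 + V y)"
    and K_pos: "0 < K"
begin

lemma F_facts: "x \<in> F \<Longrightarrow> x \<in> E" "x \<in> F \<Longrightarrow> 0 \<le> \<mu> x" "x \<in> F \<Longrightarrow> 0 < q x"
  using F_subset \<mu>_nonneg q_pos by auto

text \<open>
  The expected answer. It vanishes at negative times, so that the time integral in \<open>step\<close> may
  extend to minus infinity.
\<close>

definition target :: "'s \<Rightarrow> real \<Rightarrow> ennreal" where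
  "target y t = ennreal (\<mu> y * exp (- J * t)) * indicator {0..} t"

lemma target_measurable: "target y \<in> borel_measurable borel"
  unfolding target_def by measurable

text \<open>
  By \<open>balance\<close>, the operator multiplies \<open>\<mu> y\<close> by the integral of
  \<open>(q y - J) * exp (- q y * (t - s)) * exp (- J * s)\<close>, which is exactly what separates
  \<open>exp (- q y * t)\<close>, the case of no jump, from \<open>exp (- J * t)\<close>.
\<close>

lemma target_fixed_point:
  assumes y: "y \<in> F"
  shows "target y t = occ 0 y t + step target y t"
proof (cases "0 \<le> t")
  case True
  have "step target y t = ennreal (\<mu> y * (q y - J)) *
    (\<integral>\<^sup>+s. ennreal (exp (- q y * (t - s)) * exp (- J * s)) * indicator {0..t} s \<partial>lborel)"
    unfolding target_def using F_facts True
    by (subst step_exponential[where l="- J"]) (auto simp: balance y)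
  also have "\<dots> = ennreal (\<mu> y) * (ennreal (q y + - J) *
    (\<integral>\<^sup>+s. ennreal (exp (- q y * (t - s)) * exp (- J * s)) * indicator {0..t} s \<partial>lborel))"
    using F_facts[OF y] J_le_q[OF y] by (simp add: ennreal_mult mult.assoc)
  also have "\<dots> = ennreal (\<mu> y) * ennreal (exp (- J * t) - exp (- q y * t))"
    using J_le_q[OF y] True by (subst nn_integral_exp_convolution) auto
  finally have *: "step target y t = ennreal (\<mu> y * (exp (- J * t) - exp (- q y * t)))"
    using F_facts[OF y] J_le_q[OF y] True by (simp add: ennreal_mult mult_right_mono)
  have "J * t \<le> q y * t" using J_le_q[OF y] True by (rule mult_right_mono)
  then have "ennreal (\<mu> y * exp (- q y * t)) + ennreal (\<mu> y * (exp (- J * t) - exp (- q y * t))) =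
      ennreal (\<mu> y * exp (- q y * t) + \<mu> y * (exp (- J * t) - exp (- q y * t)))"
    using F_facts[OF y] by (intro ennreal_plus[symmetric] mult_nonneg_nonneg) auto
  also have "\<mu> y * exp (- q y * t) + \<mu> y * (exp (- J * t) - exp (- q y * t)) = \<mu> y * exp (- J * t)"
    by (simp add: algebra_simps)
  finally show ?thesis
    unfolding * using True F_facts[OF y] by (simp add: target_def occ_0)
next
  case False
  then show ?thesis using F_facts[OF y]
    by (subst step_at_negative_time) (auto simp: target_def occ_0)
qed

text \<open>
  A supersolution of the forward equation with source \<open>target\<close>. Relative to \<open>target\<close>, it bounds the
  expected number of jumps of the reversed process up to time \<open>t\<close>, plus one; the growth rate \<open>2 * K\<close> and the shift of
  \<open>V\<close> by 2 are what the estimate below needs.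
\<close>

definition bound :: "'s \<Rightarrow> real \<Rightarrow> ennreal" where
  "bound y t = ennreal (\<mu> y * (2 + V y) * exp (2 * K * t)) * indicator {0..} t"

lemma bound_supersolution:
  assumes y: "y \<in> F"
  shows "target y t + step bound y t \<le> bound y t"
proof (cases "0 \<le> t")
  case True
  note [simp] = F_facts[OF y] V_nonneg[OF y] J_le_q[OF y]
  let ?c = "2 * K"
  have qc: "0 < q y + ?c" using K_pos F_facts(3)[OF y] by linarith
  let ?I = "\<integral>\<^sup>+s. ennreal (exp (- q y * (t - s)) * exp (?c * s)) * indicator {0..t} s \<partial>lborel"
  have "ennreal (q y + ?c) * ?I = ennreal (exp (?c * t) - exp (- q y * t))"
    using qc True by (intro nn_integral_exp_convolution) auto
  also have "\<dots> \<le> ennreal (exp (?c * t))" by (intro ennreal_leI) simp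
  finally have "ennreal (inverse (q y + ?c)) * (ennreal (q y + ?c) * ?I) \<le> ennreal (inverse (q y + ?c)) * ennreal (exp (?c * t))"
    by (rule mult_left_mono) simp
  also have "ennreal (inverse (q y + ?c)) * (ennreal (q y + ?c) * ?I) = ?I"
    using qc by (simp add: mult.assoc[symmetric] ennreal_mult[symmetric])
  finally have I: "?I \<le> ennreal (exp (?c * t) / (q y + ?c))"
    using qc by (simp add: ennreal_mult[symmetric] divide_simps)
  have [simp]: "0 \<le> (3 + V y) * (\<mu> y * q y)"
    using F_facts[OF y] V_nonneg[OF y] by (intro mult_nonneg_nonneg) linarith+
  have "(\<integral>\<^sup>+x. ennreal (\<mu> x * (2 + V x)) * ennreal (\<pi> x y * q x) \<partial>count_space F) \<le>
      (\<integral>\<^sup>+x. ennreal (3 + V y) * (ennreal (\<mu> x) * ennreal (\<pi> x y * q x)) \<partial>count_space F)"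
  proof (rule nn_integral_mono)
    fix x assume "x \<in> space (count_space F)"
    then have x: "x \<in> F" by simp
    show "ennreal (\<mu> x * (2 + V x)) * ennreal (\<pi> x y * q x) \<le> ennreal (3 + V y) * (ennreal (\<mu> x) * ennreal (\<pi> x y * q x))"
    proof (cases "\<pi> x y > 0")
      case True
      have "\<mu> x * (2 + V x) * (\<pi> x y * q x) \<le> (3 + V y) * (\<mu> x * (\<pi> x y * q x))"
      proof -
        have "(\<mu> x * (\<pi> x y * q x)) * (2 + V x) \<le> (\<mu> x * (\<pi> x y * q x)) * (3 + V y)"
          using True V_step[OF x y] F_facts[OF x] by (intro mult_left_mono) auto
        then show ?thesis by (simp add: mult_ac)
      qed
      then show ?thesis
        using True F_facts[OF x] V_nonneg[OF x] by (simp add: ennreal_mult[symmetric] del: ennreal_plus)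
    next
      case False
      then have "\<pi> x y = 0" using \<pi>_nonneg[of x y] F_facts[OF x] by auto
      then show ?thesis by simp
    qed
  qed
  also have "\<dots> = ennreal (3 + V y) * ennreal (\<mu> y * (q y - J))"
    by (simp add: nn_integral_cmult balance y del: ennreal_plus)
  also have "\<dots> \<le> ennreal ((3 + V y) * (\<mu> y * q y))"
    using J_nonneg by (subst ennreal_mult[symmetric]) (auto intro!: ennreal_leI mult_left_mono)
  finally have B: "(\<integral>\<^sup>+x. ennreal (\<mu> x * (2 + V x)) * ennreal (\<pi> x y * q x) \<partial>count_space F) \<le> ennreal ((3 + V y) * (\<mu> y * q y))" .
  have "step bound y t = (\<integral>\<^sup>+x. ennreal (\<mu> x * (2 + V x)) * ennreal (\<pi> x y * q x) \<partial>count_space F) * ?I"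
    unfolding bound_def using F_facts V_nonneg True by (intro step_exponential) auto
  also have "\<dots> \<le> ennreal ((3 + V y) * (\<mu> y * q y)) * ennreal (exp (?c * t) / (q y + ?c))"
    by (intro mult_mono B I) auto
  also have "\<dots> = ennreal ((3 + V y) * (\<mu> y * q y) * (exp (?c * t) / (q y + ?c)))"
    using qc by (intro ennreal_mult[symmetric]) auto
  finally have "target y t + step bound y t \<le> ennreal (\<mu> y * exp (- J * t)) + ennreal ((3 + V y) * (\<mu> y * q y) * (exp (?c * t) / (q y + ?c)))"
    using True by (intro add_mono) (auto simp: target_def)
  also have "\<dots> = ennreal (\<mu> y * exp (- J * t) + (3 + V y) * (\<mu> y * q y) * (exp (?c * t) / (q y + ?c)))"
    using qc by (intro ennreal_plus[symmetric]) auto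
  also have "\<dots> \<le> ennreal (\<mu> y * (2 + V y) * exp (?c * t))"
  proof (rule ennreal_leI)
    have "- J * t \<le> ?c * t" using J_nonneg K_pos True by (intro mult_right_mono) auto
    then have 1: "exp (- J * t) \<le> exp (?c * t)" by simp
    \<comment> \<open>After cancellation this is \<open>2 * q y \<le> ?c * (1 + V y)\<close>, the growth bound.\<close>
    have "(q y + ?c) + (3 + V y) * q y \<le> (2 + V y) * (q y + ?c)"
      using q_growth[OF y] by (simp add: algebra_simps)
    then have 2: "1 + (3 + V y) * q y / (q y + ?c) \<le> 2 + V y"
      using qc by (simp add: field_simps)
    have "\<mu> y * exp (- J * t) + (3 + V y) * (\<mu> y * q y) * (exp (?c * t) / (q y + ?c)) \<le>
       \<mu> y * exp (?c * t) + (3 + V y) * (\<mu> y * q y) * (exp (?c * t) / (q y + ?c))"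
      using 1 by (intro add_right_mono mult_left_mono) auto
    also have "\<dots> = (\<mu> y * exp (?c * t)) * (1 + (3 + V y) * q y / (q y + ?c))"
      using qc by (simp add: field_simps)
    also have "\<dots> \<le> (\<mu> y * exp (?c * t)) * (2 + V y)"
      using 2 by (intro mult_left_mono) auto
    finally show "\<mu> y * exp (- J * t) + (3 + V y) * (\<mu> y * q y) * (exp (?c * t) / (q y + ?c)) \<le> \<mu> y * (2 + V y) * exp (?c * t)"
      by (simp add: mult_ac)
  qed
  finally show ?thesis using True by (simp add: bound_def)
next
  case False
  then show ?thesis
    by (subst step_at_negative_time) (auto simp: target_def bound_def)
qed

text \<open>
  The part of \<open>target\<close> that \<open>k\<close> iterations of the fixed point equation leave unexplained.
  Relative to \<open>target\<close>, it is the probability that the reversed process jumps at least \<open>k\<close> times up to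
  time \<open>t\<close>.
\<close>

primrec remainder :: "nat \<Rightarrow> 's \<Rightarrow> real \<Rightarrow> ennreal" where
  "remainder 0 = target"
| "remainder (Suc k) = step (remainder k)"

lemma remainder_measurable: "x \<in> F \<Longrightarrow> remainder k x \<in> borel_measurable borel"
  by (induction k arbitrary: x) (auto simp: target_measurable intro!: step_measurable)

lemma target_eq_sum_occ_plus_remainder:
  "y \<in> F \<Longrightarrow> target y t = (\<Sum>i<k. occ i y t) + remainder k y t"
proof (induction k arbitrary: y t)
  case (Suc k)
  have "target y t = occ 0 y t + step target y t"
    using Suc.prems by (rule target_fixed_point)
  also have "step target y t = step (\<lambda>x s. (\<Sum>i<k. occ i x s) + remainder k x s) y t"
    by (rule step_cong) (rule Suc.IH)
  also have "\<dots> = step (\<lambda>x s. \<Sum>i<k. occ i x s) y t + remainder (Suc k) y t"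
    using F_subset by (subst step_add) (auto intro!: borel_measurable_sum remainder_measurable occ_measurable)
  also have "step (\<lambda>x s. \<Sum>i<k. occ i x s) y t = (\<Sum>i<k. occ (Suc i) y t)"
    using F_subset by (subst step_sum) (auto intro!: occ_measurable simp: occ_Suc_step)
  finally show ?case by (simp add: sum.lessThan_Suc_shift add.assoc del: sum.lessThan_Suc)
qed simp

text \<open>
  A supersolution dominates every partial sum of the Neumann series. The series therefore
  converges, and its terms tend to zero; this is where explosion of the reversed process is
  excluded.
\<close>

lemma sum_remainder_le_bound: "y \<in> F \<Longrightarrow> (\<Sum>i<k. remainder i y t) \<le> bound y t"
proof (induction k arbitrary: y t)
  case (Suc k)
  have "(\<Sum>i<Suc k. remainder i y t) = target y t + step (\<lambda>x s. \<Sum>i<k. remainder i x s) y t"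
    by (subst step_sum) (auto simp: sum.lessThan_Suc_shift remainder_measurable simp del: sum.lessThan_Suc)
  also have "\<dots> \<le> target y t + step bound y t"
    by (intro add_left_mono step_mono Suc.IH)
  also have "\<dots> \<le> bound y t" using Suc.prems by (rule bound_supersolution)
  finally show ?case .
qed simp

lemma remainder_tendsto_0:
  assumes "y \<in> F"
  shows "(\<lambda>k. remainder k y t) \<longlonglongrightarrow> 0"
proof -
  have "(\<Sum>k. remainder k y t) \<le> bound y t"
    by (rule suminf_le_const) (auto intro: sum_remainder_le_bound assms)
  also have "bound y t < \<top>" by (auto simp: bound_def ennreal_mult_less_top split: split_indicator)
  finally have fin: "(\<Sum>k. remainder k y t) \<noteq> \<top>" by simp
  have "remainder k y t \<noteq> \<top>" for k
    using fin ennreal_suminf_lessD[of "\<lambda>k. remainder k y t" \<top> k] by (auto simp: less_top)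
  then have eq: "remainder k y t = ennreal (enn2real (remainder k y t))" for k
    by (simp add: less_top)
  \<comment> \<open>The terms are finite, so the convergence argument can be run in the reals.\<close>
  have "summable (\<lambda>k. enn2real (remainder k y t))"
    using fin eq by (intro summable_suminf_not_top) auto
  then have "(\<lambda>k. ennreal (enn2real (remainder k y t))) \<longlonglongrightarrow> ennreal 0"
    by (intro tendsto_ennrealI summable_LIMSEQ_zero)
  then show ?thesis using eq by simp
qed

theorem suminf_occ:
  assumes "y \<in> F" "0 \<le> t"
  shows "(\<Sum>k. occ k y t) = ennreal (\<mu> y * exp (- J * t))"
proof -
  have "(\<lambda>k. (\<Sum>i<k. occ i y t) + remainder k y t) \<longlonglongrightarrow> (\<Sum>k. occ k y t) + 0"
    by (intro tendsto_add summable_LIMSEQ remainder_tendsto_0 assms) auto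
  then have "(\<lambda>k. target y t) \<longlonglongrightarrow> (\<Sum>k. occ k y t)"
    using target_eq_sum_occ_plus_remainder[OF assms(1), of t] by simp
  then have "target y t = (\<Sum>k. occ k y t)"
    using LIMSEQ_unique tendsto_const by blast
  then show ?thesis using assms by (simp add: target_def)
qed

end

section \<open>States and rates of the Becker--Doering process\<close>

lemma BD_states_eventually_0:
  assumes "x \<in> BD_states"
  obtains N where "1 \<le> N" "\<And>i. N < i \<Longrightarrow> x i = 0"
proof -
  have "(\<lambda>i. real (x i)) \<longlonglongrightarrow> 0"
    using assms by (intro summable_LIMSEQ_zero) (simp add: BD_states_def)
  then have "eventually (\<lambda>i. real (x i) < 1) sequentially"
    by (rule order_tendstoD) simp
  then obtain N where "\<And>i. i \<ge> N \<Longrightarrow> x i = 0"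
    by (auto simp: eventually_sequentially)
  then show ?thesis by (intro that[of "max 1 N"]) auto
qed

lemma BD_statesI: "x 0 = 0 \<Longrightarrow> x 1 = 0 \<Longrightarrow> (\<And>i. N < i \<Longrightarrow> x i = 0) \<Longrightarrow> x \<in> BD_states"
  unfolding BD_states_def by (auto intro!: summable_finite[of "{..N}"]) (metis not_le less_irrefl)

lemma BD_states_upto_iff: "x \<in> BD_states_upto n \<longleftrightarrow> x 0 = 0 \<and> x 1 = 0 \<and> (\<forall>i>n. x i = 0)"
proof
  show "x 0 = 0 \<and> x 1 = 0 \<and> (\<forall>i>n. x i = 0) \<Longrightarrow> x \<in> BD_states_upto n"
    unfolding BD_states_upto_def by (auto intro: BD_statesI[of x n])
qed (auto simp: BD_states_upto_def BD_states_def)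

lemma countable_BD_states: "countable BD_states"
proof (rule countable_subset)
  show "BD_states \<subseteq> range (\<lambda>l j. if j < length l then l ! j else (0 :: nat))"
  proof
    fix x assume "x \<in> BD_states"
    then obtain N where N: "\<And>i. N < i \<Longrightarrow> x i = 0" by (rule BD_states_eventually_0) auto
    have "x = (\<lambda>j. if j < length (map x [0..<Suc N]) then map x [0..<Suc N] ! j else 0)"
      using N by (auto simp: fun_eq_iff simp del: upt_Suc)
    then show "x \<in> range (\<lambda>l j. if j < length l then l ! j else (0 :: nat))" by blast
  qed
qed simp

abbreviation up :: "nat \<Rightarrow> (nat \<Rightarrow> nat) \<Rightarrow> (nat \<Rightarrow> nat)" where
  "up i x \<equiv> BD_plus x (BD_Delta i)"

abbreviation down :: "nat \<Rightarrow> (nat \<Rightarrow> nat) \<Rightarrow> (nat \<Rightarrow> nat)" where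
  "down i x \<equiv> BD_minus x (BD_Delta i)"

lemma up_apply: "up i x j = (if j = i + 1 then x j + 1 else if 2 \<le> i \<and> j = i then x j - 1 else x j)"
  by (auto simp: BD_plus_def BD_Delta_def nat_add_distrib nat_diff_distrib)

lemma down_apply: "down i x j = (if j = i + 1 then x j - 1 else if 2 \<le> i \<and> j = i then x j + 1 else x j)"
  by (auto simp: BD_minus_def BD_Delta_def nat_add_distrib nat_diff_distrib)

lemma up_neq: "up i x \<noteq> x"
  by (metis up_apply n_not_Suc_n Suc_eq_plus1)

lemma down_neq: "1 \<le> x (i + 1) \<Longrightarrow> down i x \<noteq> x"
proof
  assume "1 \<le> x (i + 1)" "down i x = x"
  then have "x (i + 1) - 1 = x (i + 1)" by (metis down_apply)
  with \<open>1 \<le> x (i + 1)\<close> show False by simp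
qed

text \<open>
  Where the forward jump has a positive rate, the truncated subtraction does no harm and the two
  shifts invert each other.
\<close>

lemma up_eq_iff:
  assumes "1 \<le> i" "i = 1 \<or> 1 \<le> x i"
  shows "up i x = y \<longleftrightarrow> 1 \<le> y (i + 1) \<and> down i y = x"
proof
  assume "up i x = y"
  then have y: "y = up i x" by simp
  show "1 \<le> y (i + 1) \<and> down i y = x"
    unfolding y using assms by (auto simp: fun_eq_iff up_apply down_apply)
next
  assume y: "1 \<le> y (i + 1) \<and> down i y = x"
  then have x: "x = down i y" by simp
  show "up i x = y"
    unfolding x using assms y by (auto simp: fun_eq_iff up_apply down_apply)
qed

lemma down_eq_iff:
  assumes "1 \<le> i" "1 \<le> x (i + 1)"
  shows "down i x = y \<longleftrightarrow> (i = 1 \<or> 1 \<le> y i) \<and> up i y = x"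
proof
  assume "down i x = y"
  then have y: "y = down i x" by simp
  show "(i = 1 \<or> 1 \<le> y i) \<and> up i y = x"
    unfolding y using assms by (auto simp: fun_eq_iff up_apply down_apply)
next
  assume y: "(i = 1 \<or> 1 \<le> y i) \<and> up i y = x"
  then have x: "x = up i y" by simp
  show "down i x = y"
    unfolding x using assms y by (auto simp: fun_eq_iff up_apply down_apply)
qed

locale becker_doering =
  fixes a b :: "nat \<Rightarrow> real" and z :: real
  assumes z_pos: "0 < z"
    and a_pos: "\<And>i. 1 \<le> i \<Longrightarrow> 0 < a i"
    and b_pos: "\<And>i. 2 \<le> i \<Longrightarrow> 0 < b i"
begin

definition up_rate :: "nat \<Rightarrow> (nat \<Rightarrow> nat) \<Rightarrow> real" where
  "up_rate i x = a i * z * BD_conc z x i"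

definition down_rate :: "nat \<Rightarrow> (nat \<Rightarrow> nat) \<Rightarrow> real" where
  "down_rate i x = b (i + 1) * BD_conc z x (i + 1)"

lemma up_rate_nonneg: "1 \<le> i \<Longrightarrow> 0 \<le> up_rate i x"
  using z_pos a_pos[of i] by (simp add: up_rate_def BD_conc_def)

lemma down_rate_nonneg: "1 \<le> i \<Longrightarrow> 0 \<le> down_rate i x"
  using z_pos b_pos[of "i + 1"] by (simp add: down_rate_def BD_conc_def)

lemma up_rate_neq_0: "1 \<le> i \<Longrightarrow> up_rate i x \<noteq> 0 \<Longrightarrow> i = 1 \<or> 1 \<le> x i"
  by (auto simp: up_rate_def BD_conc_def split: if_splits)

lemma down_rate_neq_0: "1 \<le> i \<Longrightarrow> down_rate i x \<noteq> 0 \<Longrightarrow> 1 \<le> x (i + 1)"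
  by (auto simp: down_rate_def BD_conc_def split: if_splits)

lemma BD_generator_finite_sum:
  assumes "1 \<le> N" "\<And>i. N < i \<Longrightarrow> x i = 0"
  shows "BD_generator a b z \<psi> x =
    (\<Sum>i=1..N. up_rate i x * (\<psi> (up i x) - \<psi> x) + down_rate i x * (\<psi> (down i x) - \<psi> x))"
proof -
  have "BD_generator a b z \<psi> x =
    (\<Sum>\<^sub>\<infinity>i\<in>{1..N}. up_rate i x * (\<psi> (up i x) - \<psi> x) + down_rate i x * (\<psi> (down i x) - \<psi> x))"
    unfolding BD_generator_def up_rate_def down_rate_def
    using assms by (intro infsum_cong_neutral) (auto simp: BD_conc_def)
  then show ?thesis by simp
qed

abbreviation rate :: "(nat \<Rightarrow> nat) \<Rightarrow> real" where
  "rate \<equiv> exit_rate (BD_generator a b z)"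

abbreviation jump :: "(nat \<Rightarrow> nat) \<Rightarrow> (nat \<Rightarrow> nat) \<Rightarrow> real" where
  "jump \<equiv> jump_prob (BD_generator a b z)"

lemma rate_eq:
  assumes "1 \<le> N" "\<And>i. N < i \<Longrightarrow> x i = 0"
  shows "rate x = (\<Sum>i=1..N. up_rate i x + down_rate i x)"
proof -
  have "rate x = (\<Sum>i=1..N. - (up_rate i x * (indicator {x} (up i x) - indicator {x} x) +
     down_rate i x * (indicator {x} (down i x) - indicator {x} x)))"
    unfolding exit_rate_def by (subst BD_generator_finite_sum[where x=x, OF assms]) (simp_all add: sum_negf del: minus_add_distrib)
  also have "\<dots> = (\<Sum>i=1..N. up_rate i x + down_rate i x)"
  proof (intro sum.cong refl)
    fix i assume "i \<in> {1..N}"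
    then show "- (up_rate i x * (indicator {x} (up i x) - indicator {x} x) +
     down_rate i x * (indicator {x} (down i x) - indicator {x} x)) = up_rate i x + down_rate i x"
      using down_rate_neq_0[of i x] down_neq[of x i] up_neq[of x i]
      by (cases "down_rate i x = 0") auto
  qed
  finally show ?thesis .
qed

lemma rate_pos:
  assumes "x \<in> BD_states"
  shows "0 < rate x"
proof -
  obtain N where N: "1 \<le> N" "\<And>i. N < i \<Longrightarrow> x i = 0"
    using BD_states_eventually_0[OF assms] by blast
  have "0 < up_rate 1 x" using a_pos[of 1] z_pos by (simp add: up_rate_def BD_conc_def)
  also have "\<dots> \<le> up_rate 1 x + down_rate 1 x" by (simp add: down_rate_nonneg)
  also have "\<dots> \<le> (\<Sum>i=1..N. up_rate i x + down_rate i x)"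
    using N(1) by (intro member_le_sum) (auto simp: up_rate_nonneg down_rate_nonneg add_nonneg_nonneg)
  also have "\<dots> = rate x" using N by (rule rate_eq[symmetric])
  finally show ?thesis .
qed

lemma jump_times_rate:
  assumes "x \<in> BD_states" "1 \<le> N" "\<And>i. N < i \<Longrightarrow> x i = 0"
  shows "jump x y * rate x =
    (\<Sum>i=1..N. up_rate i x * indicator {y} (up i x) + down_rate i x * indicator {y} (down i x))"
proof (cases "x = y")
  case True
  have "(\<Sum>i=1..N. up_rate i x * indicator {y} (up i x) + down_rate i x * indicator {y} (down i x)) = 0"
  proof (intro sum.neutral ballI)
    fix i assume "i \<in> {1..N}"
    then show "up_rate i x * indicator {y} (up i x) + down_rate i x * indicator {y} (down i x) = 0"
      using True down_rate_neq_0[of i x] down_neq[of x i] up_neq[of x i]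
      by (cases "down_rate i x = 0") auto
  qed
  with True show ?thesis by (simp add: jump_prob_def)
next
  case False
  then have "jump x y * rate x = BD_generator a b z (indicator {y}) x"
    using rate_pos[OF assms(1)] by (simp add: jump_prob_def)
  then show ?thesis
    using False by (subst (asm) BD_generator_finite_sum[OF assms(2,3)]) auto
qed

lemma jump_nonneg:
  assumes "x \<in> BD_states"
  shows "0 \<le> jump x y"
proof -
  obtain N where N: "1 \<le> N" "\<And>i. N < i \<Longrightarrow> x i = 0"
    using BD_states_eventually_0[OF assms] by blast
  have "0 \<le> jump x y * rate x"
    using N assms by (subst jump_times_rate[where N=N])
      (auto intro!: sum_nonneg add_nonneg_nonneg mult_nonneg_nonneg simp: up_rate_nonneg down_rate_nonneg)
  then show ?thesis using rate_pos[OF assms] by (simp add: zero_le_mult_iff)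
qed

end

section \<open>The product Poisson law is an eigenvector of the truncated generator\<close>

locale truncated_becker_doering = becker_doering +
  fixes n :: nat
  assumes n_ge_2: "2 \<le> n"
begin

abbreviation Q :: "nat \<Rightarrow> real" where "Q \<equiv> BD_Q a b"
abbreviation J :: real where "J \<equiv> BD_J a b z n"
abbreviation f :: "nat \<Rightarrow> real" where "f \<equiv> BD_f a b z n"
abbreviation E\<^sub>n :: "(nat \<Rightarrow> nat) set" where "E\<^sub>n \<equiv> BD_states_upto n"

lemma Q_pos: "0 < Q i"
  unfolding BD_Q_def using a_pos b_pos by (intro divide_pos_pos prod_pos) auto

lemma Q_Suc: "1 \<le> i \<Longrightarrow> b (i + 1) * Q (i + 1) = a i * Q i"
proof -
  assume i: "1 \<le> i"
  have "{1..<i + 1} = insert i {1..<i}" "{2..i + 1} = insert (i + 1) {2..i}" using i by auto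
  then have *: "(\<Prod>k=1..<i + 1. a k) = a i * (\<Prod>k=1..<i. a k)"
    "(\<Prod>k=2..i + 1. b k) = b (i + 1) * (\<Prod>k=2..i. b k)" by simp_all
  have "b (i + 1) \<noteq> 0" using b_pos[of "i + 1"] i by simp
  then show ?thesis unfolding BD_Q_def * by simp
qed

text \<open>
  Think of cluster growth as a chain of resistors: the current \<open>J\<close> is the reciprocal of the total
  resistance, and \<open>f i / (Q i * z ^ i)\<close> is the potential at \<open>i\<close>, equal to 1 at \<open>i = 1\<close> and 0 at
  \<open>i = n + 1\<close>.
\<close>

abbreviation resistance :: "nat \<Rightarrow> real" where
  "resistance k \<equiv> 1 / (a k * Q k * z ^ (k + 1))"

lemma resistance_pos: "1 \<le> k \<Longrightarrow> 0 < resistance k"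
  using a_pos[of k] Q_pos[of k] z_pos by (intro divide_pos_pos mult_pos_pos zero_less_power) auto

lemma J_pos: "0 < J"
  unfolding BD_J_def using n_ge_2 by (intro positive_imp_inverse_positive sum_pos resistance_pos) auto

lemma f_pos: "1 \<le> i \<Longrightarrow> i \<le> n \<Longrightarrow> 0 < f i"
  unfolding BD_f_def
  by (intro mult_pos_pos J_pos Q_pos zero_less_power z_pos sum_pos resistance_pos) auto

text \<open>
  With \<open>f 1 = z\<close>, the convention that the concentration of monomers is \<open>z\<close> makes the formulas
  below uniform in \<open>i\<close>.
\<close>

lemma f_1: "f 1 = z"
  using J_pos by (simp add: BD_f_def BD_J_def BD_Q_def)

text \<open>
  Under the product Poisson law the left side is the mean rate of leaving the truncated state space,
  which is why the survival probability decays with rate \<open>J\<close>.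
\<close>

lemma flux_last: "a n * z * f n = J"
  using a_pos[of n] Q_pos[of n] z_pos n_ge_2 by (simp add: BD_f_def field_simps)

text \<open>
  The Poisson means are the stationary profile of the deterministic Becker--Doering equations with
  monomer concentration \<open>z\<close> and absorption at size \<open>n + 1\<close>; stationarity forces a constant current.
\<close>

lemma flux:
  assumes "1 \<le> i" "i < n"
  shows "a i * z * f i = b (i + 1) * f (i + 1) + J"
proof -
  have split: "(\<Sum>k=i..n. resistance k) = resistance i + (\<Sum>k=i+1..n. resistance k)"
    using assms by (subst sum.atLeast_Suc_atMost) auto
  have "b (i + 1) * f (i + 1) = J * (b (i + 1) * Q (i + 1)) * z ^ (i + 1) * (\<Sum>k=i+1..n. resistance k)"
    by (simp add: BD_f_def mult_ac)
  also have "\<dots> = J * (a i * Q i * z ^ (i + 1)) * (\<Sum>k=i+1..n. resistance k)"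
    unfolding Q_Suc[OF assms(1)] by (simp add: mult_ac)
  finally have 1: "b (i + 1) * f (i + 1) = J * (a i * Q i * z ^ (i + 1)) * (\<Sum>k=i+1..n. resistance k)" .
  have "a i * z * f i = J * (a i * Q i * z ^ (i + 1)) * (\<Sum>k=i..n. resistance k)"
    by (simp add: BD_f_def mult_ac)
  also have "\<dots> = J * ((a i * Q i * z ^ (i + 1)) * resistance i) + b (i + 1) * f (i + 1)"
    unfolding split 1 by (simp only: distrib_left mult.assoc)
  also have "(a i * Q i * z ^ (i + 1)) * resistance i = 1"
    using a_pos[of i] Q_pos[of i] z_pos assms by simp
  finally show ?thesis by simp
qed

text \<open>
  The left side sums the rates of the reversed jumps, the right side those of the forward jumps. By
  \<open>flux\<close>, the terms of index \<open>i\<close> differ by \<open>J * (c (i + 1) / f (i + 1) - c i / f i)\<close>, which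
  telescopes.
\<close>

lemma scaled_flux_sum:
  assumes "1 \<le> m" "m \<le> n"
  shows "(\<Sum>i=1..<m. a i * z * f i / f (i + 1) * c (i + 1) + b (i + 1) * f (i + 1) / f i * c i) =
    (\<Sum>i=1..<m. a i * z * c i + b (i + 1) * c (i + 1)) + J * (c m / f m - c 1 / f 1)"
  using assms
proof (induction m rule: dec_induct)
  case (step k)
  have f: "0 < f k" "0 < f (k + 1)" using step by (auto intro!: f_pos)
  have fl: "a k * z * f k = b (k + 1) * f (k + 1) + J" using step by (intro flux) auto
  have 1: "a k * z * f k / f (k + 1) = b (k + 1) + J / f (k + 1)"
    unfolding fl using f by (simp add: field_simps)
  have 2: "b (k + 1) * f (k + 1) / f k = a k * z - J / f k"
    using fl f by (simp add: field_simps)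
  have s: "(\<Sum>i=1..<Suc k. g i) = (\<Sum>i=1..<k. g i) + g k" for g :: "nat \<Rightarrow> real"
    using step by simp
  show ?case
    unfolding s 1 2 step.IH[OF less_imp_le[OF Suc_le_lessD[OF step.prems]]]
    by (simp add: algebra_simps)
qed simp

lemma sum_last: "(\<Sum>i=1..n. g i) = (\<Sum>i=1..<n. g i) + (g n :: real)"
proof -
  have "{1..n} = insert n {1..<n}" using n_ge_2 by auto
  then show ?thesis by simp
qed

definition \<nu> :: "(nat \<Rightarrow> nat) \<Rightarrow> real" where
  "\<nu> x = (\<Prod>i=2..n. f i ^ x i / fact (x i) * exp (- f i))"

lemma \<nu>_pos: "0 < \<nu> x"
  unfolding \<nu>_def using f_pos by (intro prod_pos) auto

text \<open>
  Poisson weights satisfy \<open>weight (c + 1) * (c + 1) = weight c * mean\<close>; it is applied at size \<open>i + 1\<close>,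
  which gains a cluster, and, unless \<open>i = 1\<close>, at size \<open>i\<close>, which loses one.
\<close>

lemma \<nu>_up:
  assumes i: "1 \<le> i" "i < n" "i = 1 \<or> 1 \<le> x i"
  shows "\<nu> (up i x) * up i x (i + 1) * f i = \<nu> x * BD_conc z x i * f (i + 1)"
proof -
  define w where "w j c = f j ^ c / fact c * exp (- f j)" for j c
  have w: "w j (Suc c) * (1 + real c) = w j c * f j" for j c
  proof -
    have "v / (k * g) * e * k = v / g * e" if "k \<noteq> 0" for v k g e :: real
      using that by simp
    from this[of "1 + real c" "f j ^ Suc c" "fact c" "exp (- f j)"] show ?thesis
      by (simp add: w_def mult_ac)
  qed
  have \<nu>: "\<nu> y = (\<Prod>j=2..n. w j (y j))" for y by (simp add: \<nu>_def w_def)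
  show ?thesis
  proof (cases "i = 1")
    case True
    let ?R = "{2..n} - {2}"
    have s: "(\<Prod>j=2..n. g j) = g 2 * (\<Prod>j\<in>?R. g j)" for g :: "nat \<Rightarrow> real"
      using n_ge_2 by (intro prod.remove) auto
    have "\<nu> (up i x) = w 2 (Suc (x 2)) * (\<Prod>j\<in>?R. w j (x j))"
      unfolding \<nu> s using True by (auto simp: up_apply intro!: prod.cong arg_cong2[where f="(*)"])
    moreover have "\<nu> x = w 2 (x 2) * (\<Prod>j\<in>?R. w j (x j))" unfolding \<nu> s ..
    ultimately show ?thesis
      using True w[of 2 "x 2"] f_1 by (simp add: up_apply BD_conc_def numeral_2_eq_2)
  next
    case False
    then have i2: "2 \<le> i" "1 \<le> x i" using i by auto
    then obtain c where c: "x i = Suc c" by (cases "x i") auto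
    let ?R = "{2..n} - {i} - {i + 1}"
    have s: "(\<Prod>j=2..n. g j) = g i * (g (i + 1) * (\<Prod>j\<in>?R. g j))" for g :: "nat \<Rightarrow> real"
      using i2 i by (subst prod.remove[of _ i], simp, simp, subst prod.remove[of _ "i + 1"]) auto
    have R: "(\<Prod>j\<in>?R. w j (up i x j)) = (\<Prod>j\<in>?R. w j (x j))"
      by (intro prod.cong) (auto simp: up_apply)
    have "\<nu> (up i x) = w i c * (w (i + 1) (Suc (x (i + 1))) * (\<Prod>j\<in>?R. w j (x j)))"
      unfolding \<nu> s R using i2 c by (simp add: up_apply)
    moreover have "\<nu> x = w i (Suc c) * (w (i + 1) (x (i + 1)) * (\<Prod>j\<in>?R. w j (x j)))"
      unfolding \<nu> s using c by simp
    moreover have "up i x (i + 1) = Suc (x (i + 1))" "BD_conc z x i = 1 + real c"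
      using i2 c by (simp_all add: up_apply BD_conc_def)
    moreover have "w i c * (w (i + 1) (Suc (x (i + 1))) * R) * (1 + real (x (i + 1))) * f i =
       w i (Suc c) * (w (i + 1) (x (i + 1)) * R) * (1 + real c) * f (i + 1)" for R
    proof -
      have "w i c * (w (i + 1) (Suc (x (i + 1))) * R) * (1 + real (x (i + 1))) * f i =
        (w i c * f i) * (w (i + 1) (Suc (x (i + 1))) * (1 + real (x (i + 1)))) * R"
        by (simp add: mult_ac)
      also have "\<dots> = (w i (Suc c) * (1 + real c)) * (w (i + 1) (x (i + 1)) * f (i + 1)) * R"
        by (simp only: w)
      finally show ?thesis by (simp add: mult_ac)
    qed
    ultimately show ?thesis by (simp only: of_nat_Suc)
  qed
qed

lemma up_in_E\<^sub>n: "y \<in> E\<^sub>n \<Longrightarrow> 1 \<le> i \<Longrightarrow> i < n \<Longrightarrow> up i y \<in> E\<^sub>n"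
  by (auto simp: BD_states_upto_iff up_apply)

lemma down_in_E\<^sub>n: "y \<in> E\<^sub>n \<Longrightarrow> 1 \<le> i \<Longrightarrow> i < n \<Longrightarrow> down i y \<in> E\<^sub>n"
  by (auto simp: BD_states_upto_iff down_apply)

text \<open>
  Only one predecessor contributes, and \<open>\<nu>_up\<close> expresses its weight through that of \<open>y\<close>.
\<close>

lemma inflow_from_up:
  assumes y: "y \<in> E\<^sub>n" and i: "1 \<le> i" "i < n"
  shows "(\<integral>\<^sup>+x. ennreal (\<nu> x * (up_rate i x * indicator {y} (up i x))) \<partial>count_space E\<^sub>n) =
    ennreal (\<nu> y * (a i * z * f i / f (i + 1) * BD_conc z y (i + 1)))"
proof (cases "1 \<le> y (i + 1)")
  case True
  let ?x = "down i y"
  have x: "i = 1 \<or> 1 \<le> ?x i" using i by (auto simp: down_apply)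
  have up: "up i ?x = y" using True i x by (subst up_eq_iff) auto
  have "(\<integral>\<^sup>+x. ennreal (\<nu> x * (up_rate i x * indicator {y} (up i x))) \<partial>count_space E\<^sub>n) =
     (\<integral>\<^sup>+x. ennreal (\<nu> ?x * up_rate i ?x) * indicator {?x} x \<partial>count_space E\<^sub>n)"
  proof (rule nn_integral_cong)
    fix x
    show "ennreal (\<nu> x * (up_rate i x * indicator {y} (up i x))) = ennreal (\<nu> ?x * up_rate i ?x) * indicator {?x} x"
    proof (cases "x = ?x")
      case False
      then have "up_rate i x = 0 \<or> up i x \<noteq> y"
        using up_rate_neq_0[of i x] up_eq_iff[of i x y] i by auto
      then show ?thesis using False by auto
    qed (simp add: up)
  qed
  also have "\<dots> = ennreal (\<nu> ?x * up_rate i ?x)"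
    using down_in_E\<^sub>n[OF y i] by (simp add: nn_integral_cmult)
  also have "\<nu> ?x * up_rate i ?x = \<nu> y * (a i * z * f i / f (i + 1) * BD_conc z y (i + 1))"
    using \<nu>_up[where x="?x", OF i x] f_pos[of i] f_pos[of "i + 1"] i unfolding up
    by (simp add: up_rate_def BD_conc_def[of z y] field_simps)
  finally show ?thesis .
next
  case False
  then have "up i x \<noteq> y" for x by (auto simp: up_apply)
  moreover have "BD_conc z y (i + 1) = 0" using False i by (simp add: BD_conc_def Suc_le_eq)
  ultimately show ?thesis by simp
qed

lemma inflow_from_down:
  assumes y: "y \<in> E\<^sub>n" and i: "1 \<le> i" "i < n"
  shows "(\<integral>\<^sup>+x. ennreal (\<nu> x * (down_rate i x * indicator {y} (down i x))) \<partial>count_space E\<^sub>n) =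
    ennreal (\<nu> y * (b (i + 1) * f (i + 1) / f i * BD_conc z y i))"
proof (cases "i = 1 \<or> 1 \<le> y i")
  case True
  let ?x = "up i y"
  have x: "1 \<le> ?x (i + 1)" by (simp add: up_apply)
  have down: "down i ?x = y" using True i x by (subst down_eq_iff) auto
  have "(\<integral>\<^sup>+x. ennreal (\<nu> x * (down_rate i x * indicator {y} (down i x))) \<partial>count_space E\<^sub>n) =
     (\<integral>\<^sup>+x. ennreal (\<nu> ?x * down_rate i ?x) * indicator {?x} x \<partial>count_space E\<^sub>n)"
  proof (rule nn_integral_cong)
    fix x
    show "ennreal (\<nu> x * (down_rate i x * indicator {y} (down i x))) = ennreal (\<nu> ?x * down_rate i ?x) * indicator {?x} x"
    proof (cases "x = ?x")
      case False
      then have "down_rate i x = 0 \<or> down i x \<noteq> y"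
        using down_rate_neq_0[of i x] down_eq_iff[of i x y] i by auto
      then show ?thesis using False by auto
    qed (simp add: down)
  qed
  also have "\<dots> = ennreal (\<nu> ?x * down_rate i ?x)"
    using up_in_E\<^sub>n[OF y i] by (simp add: nn_integral_cmult)
  also have "\<nu> ?x * down_rate i ?x = \<nu> y * (b (i + 1) * f (i + 1) / f i * BD_conc z y i)"
    using \<nu>_up[where x=y, OF i True] f_pos[of i] f_pos[of "i + 1"] i
    by (simp add: down_rate_def BD_conc_def[of z "up i y"] field_simps)
  finally show ?thesis .
next
  case False
  then have "down i x \<noteq> y" for x using i by (auto simp: down_apply)
  moreover have "BD_conc z y i = 0" using False i by (simp add: BD_conc_def Suc_le_eq)
  ultimately show ?thesis by simp
qed

lemma E\<^sub>n_subset: "E\<^sub>n \<subseteq> BD_states"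
  by (auto simp: BD_states_upto_def)

lemma E\<^sub>n_0: "x \<in> E\<^sub>n \<Longrightarrow> n < i \<Longrightarrow> x i = 0"
  by (simp add: BD_states_upto_iff)

lemma rate_minus_J:
  assumes "y \<in> E\<^sub>n"
  shows "rate y - J = (\<Sum>i=1..<n. a i * z * f i / f (i + 1) * BD_conc z y (i + 1) +
    b (i + 1) * f (i + 1) / f i * BD_conc z y i)"
proof -
  let ?c = "BD_conc z y"
  have n: "1 \<le> n" using n_ge_2 by simp
  have "rate y = (\<Sum>i=1..n. a i * z * ?c i + b (i + 1) * ?c (i + 1))"
    using n E\<^sub>n_0[OF assms] by (subst rate_eq[where x=y and N=n]) (auto simp: up_rate_def down_rate_def)
  also have "\<dots> = (\<Sum>i=1..<n. a i * z * ?c i + b (i + 1) * ?c (i + 1)) + a n * z * ?c n"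
    unfolding sum_last using n E\<^sub>n_0[OF assms, of "n + 1"] by (simp add: BD_conc_def)
  also have "a n * z * ?c n = J * (?c n / f n)"
    unfolding flux_last[symmetric] using f_pos[of n] n by simp
  also have "\<dots> = J * (?c n / f n - ?c 1 / f 1) + J"
    using z_pos by (simp only: f_1) (simp add: BD_conc_def algebra_simps)
  finally show ?thesis
    using scaled_flux_sum[of n ?c] n by simp
qed

lemma J_le_rate:
  assumes "y \<in> E\<^sub>n"
  shows "J \<le> rate y"
proof -
  have "0 \<le> rate y - J"
    unfolding rate_minus_J[OF assms]
  proof (intro sum_nonneg)
    fix i assume i: "i \<in> {1..<n}"
    then show "0 \<le> a i * z * f i / f (i + 1) * BD_conc z y (i + 1) + b (i + 1) * f (i + 1) / f i * BD_conc z y i"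
      using a_pos[of i] b_pos[of "i + 1"] z_pos f_pos[of i] f_pos[of "i + 1"]
      by (auto simp: BD_conc_def intro!: add_nonneg_nonneg mult_nonneg_nonneg divide_nonneg_nonneg)
  qed
  then show ?thesis by simp
qed

text \<open>
  The jump at index \<open>n\<close> leads out of the truncated state space, so it never leads into \<open>y\<close>; this is
  why the sums run over \<open>i < n\<close> although the exit rate has a term of index \<open>n\<close>.
\<close>

lemma \<nu>_balance:
  assumes y: "y \<in> E\<^sub>n"
  shows "(\<integral>\<^sup>+x. ennreal (\<nu> x) * ennreal (jump x y * rate x) \<partial>count_space E\<^sub>n) = ennreal (\<nu> y * (rate y - J))"
proof -
  have n: "1 \<le> n" using n_ge_2 by simp
  let ?u = "\<lambda>i x. ennreal (\<nu> x * (up_rate i x * indicator {y} (up i x)))"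
  let ?d = "\<lambda>i x. ennreal (\<nu> x * (down_rate i x * indicator {y} (down i x)))"
  let ?U = "\<lambda>i. a i * z * f i / f (i + 1) * BD_conc z y (i + 1)"
  let ?D = "\<lambda>i. b (i + 1) * f (i + 1) / f i * BD_conc z y i"
  have "(\<integral>\<^sup>+x. ennreal (\<nu> x) * ennreal (jump x y * rate x) \<partial>count_space E\<^sub>n) =
      (\<integral>\<^sup>+x. (\<Sum>i=1..<n. ?u i x + ?d i x) \<partial>count_space E\<^sub>n)"
  proof (rule nn_integral_cong)
    fix x assume "x \<in> space (count_space E\<^sub>n)"
    then have x: "x \<in> E\<^sub>n" "x \<in> BD_states" using E\<^sub>n_subset by auto
    have "up n x \<noteq> y" using E\<^sub>n_0[OF y, of "n + 1"] by (auto simp: up_apply)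
    moreover have "down_rate n x = 0" using E\<^sub>n_0[OF x(1), of "n + 1"] n by (simp add: down_rate_def BD_conc_def)
    ultimately have "jump x y * rate x =
       (\<Sum>i=1..<n. up_rate i x * indicator {y} (up i x) + down_rate i x * indicator {y} (down i x))"
      using n E\<^sub>n_0[OF x(1)] by (subst jump_times_rate[where x=x and N=n, OF x(2)]) (auto simp: sum_last simp del: One_nat_def)
    moreover have "0 \<le> jump x y * rate x"
      using jump_nonneg[OF x(2)] rate_pos[OF x(2)] by simp
    ultimately have "ennreal (\<nu> x) * ennreal (jump x y * rate x) =
       ennreal (\<Sum>i=1..<n. \<nu> x * (up_rate i x * indicator {y} (up i x)) + \<nu> x * (down_rate i x * indicator {y} (down i x)))"
      using \<nu>_pos[of x] by (subst ennreal_mult[symmetric]) (auto simp: sum_distrib_left distrib_left)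
    also have "\<dots> = (\<Sum>i=1..<n. ?u i x + ?d i x)"
      using \<nu>_pos[of x] up_rate_nonneg down_rate_nonneg
      by (subst sum_ennreal[symmetric]) (auto intro!: sum.cong ennreal_plus add_nonneg_nonneg mult_nonneg_nonneg)
    finally show "ennreal (\<nu> x) * ennreal (jump x y * rate x) = (\<Sum>i=1..<n. ?u i x + ?d i x)" .
  qed
  also have "\<dots> = (\<Sum>i=1..<n. integral\<^sup>N (count_space E\<^sub>n) (?u i) + integral\<^sup>N (count_space E\<^sub>n) (?d i))"
    by (subst nn_integral_sum) (auto simp: nn_integral_add)
  also have "\<dots> = (\<Sum>i=1..<n. ennreal (\<nu> y * (?U i)) + ennreal (\<nu> y * (?D i)))"
    using y by (intro sum.cong) (auto simp: inflow_from_up[simplified] inflow_from_down[simplified])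
  also have "\<dots> = (\<Sum>i=1..<n. ennreal (\<nu> y * (?U i) + \<nu> y * (?D i)))"
  proof (intro sum.cong refl ennreal_plus[symmetric])
    fix i assume i: "i \<in> {1..<n}"
    then have "0 \<le> ?U i" "0 \<le> ?D i"
      using a_pos[of i] b_pos[of "i + 1"] z_pos f_pos[of i] f_pos[of "i + 1"]
      by (auto simp: BD_conc_def intro!: mult_nonneg_nonneg divide_nonneg_nonneg)
    then show "0 \<le> \<nu> y * ?U i" "0 \<le> \<nu> y * ?D i" by - (rule mult_nonneg_nonneg[OF less_imp_le[OF \<nu>_pos]], assumption)+
  qed
  also have "\<dots> = ennreal (\<Sum>i=1..<n. \<nu> y * (?U i) + \<nu> y * (?D i))"
  proof (rule sum_ennreal)
    fix i assume i: "i \<in> {1..<n}"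
    then have "0 \<le> ?U i" "0 \<le> ?D i"
      using a_pos[of i] b_pos[of "i + 1"] z_pos f_pos[of i] f_pos[of "i + 1"]
      by (auto simp: BD_conc_def intro!: mult_nonneg_nonneg divide_nonneg_nonneg)
    then show "0 \<le> \<nu> y * ?U i + \<nu> y * ?D i" by (intro add_nonneg_nonneg mult_nonneg_nonneg[OF less_imp_le[OF \<nu>_pos]])
  qed
  also have "(\<Sum>i=1..<n. \<nu> y * (?U i) + \<nu> y * (?D i)) = \<nu> y * (rate y - J)"
    unfolding rate_minus_J[OF y] by (simp only: sum_distrib_left distrib_left)
  finally show ?thesis .
qed

definition clusters :: "(nat \<Rightarrow> nat) \<Rightarrow> real" where
  "clusters x = (\<Sum>j=2..n. real (x j))"

lemma clusters_nonneg: "0 \<le> clusters x"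
  unfolding clusters_def by (intro sum_nonneg) simp

lemma clusters_le:
  assumes "\<And>j. real (x j) \<le> real (y j) + (if j = k then 1 else 0)"
  shows "clusters x \<le> clusters y + 1"
proof -
  have "clusters x \<le> (\<Sum>j=2..n. real (y j) + (if j = k then 1 else 0))"
    unfolding clusters_def by (intro sum_mono assms)
  also have "\<dots> \<le> clusters y + 1"
    by (simp add: clusters_def sum.distrib sum.delta)
  finally show ?thesis .
qed

lemma clusters_jump:
  assumes "x \<in> E\<^sub>n" "0 < jump x y"
  shows "clusters x \<le> clusters y + 1"
proof -
  have x: "x \<in> BD_states" using assms E\<^sub>n_subset by auto
  have "0 < jump x y * rate x" using assms(2) rate_pos[OF x] by simp
  then have "0 < (\<Sum>i=1..n. up_rate i x * indicator {y} (up i x) + down_rate i x * indicator {y} (down i x))"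
    using jump_times_rate[OF x, of n y] E\<^sub>n_0[OF assms(1)] n_ge_2 by simp
  then obtain i where "i \<in> {1..n}" "up_rate i x * indicator {y} (up i x) + down_rate i x * indicator {y} (down i x) \<noteq> 0"
    by (metis (no_types, lifting) sum.neutral less_irrefl)
  then have "up i x = y \<or> down i x = y"
    by (cases "up i x = y"; cases "down i x = y") auto
  then consider "up i x = y" | "down i x = y" by blast
  then show ?thesis
  proof cases
    case 1
    show ?thesis by (rule clusters_le[of _ _ i]) (auto simp: 1[symmetric] up_apply)
  next
    case 2
    show ?thesis by (rule clusters_le[of _ _ "i + 1"]) (auto simp: 2[symmetric] down_apply)
  qed
qed

text \<open>
  The constant of the linear bound in \<open>rate_growth\<close>. The factor \<open>1 + z\<close> accounts for the monomers,
  which are not counted in \<open>clusters\<close>.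
\<close>

definition growth :: real where
  "growth = (\<Sum>i=1..n. (a i * z + b (i + 1)) * (1 + z))"

lemma growth_pos: "0 < growth"
  unfolding growth_def using n_ge_2 a_pos b_pos z_pos
  by (intro sum_pos mult_pos_pos add_pos_pos) auto

lemma rate_growth:
  assumes y: "y \<in> E\<^sub>n"
  shows "rate y \<le> growth * (1 + clusters y)"
proof -
  have c: "BD_conc z y i \<le> (1 + z) * (1 + clusters y)" if "1 \<le> i" for i
  proof -
    have "0 \<le> clusters y * z" using clusters_nonneg[of y] z_pos by simp
    moreover have "real (y i) \<le> clusters y" if "i \<noteq> 1"
    proof (cases "i \<le> n")
      case True
      then show ?thesis unfolding clusters_def using that \<open>1 \<le> i\<close> by (intro member_le_sum) auto
    next
      case False
      then show ?thesis using E\<^sub>n_0[OF y, of i] clusters_nonneg[of y] by simp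
    qed
    moreover have "(1 + z) * (1 + clusters y) = 1 + z + clusters y + clusters y * z"
      by (simp add: algebra_simps)
    ultimately show ?thesis
      using clusters_nonneg[of y] z_pos unfolding BD_conc_def by (smt (verit))
  qed
  have "rate y = (\<Sum>i=1..n. a i * z * BD_conc z y i + b (i + 1) * BD_conc z y (i + 1))"
    using n_ge_2 E\<^sub>n_0[OF y] by (subst rate_eq[where x=y and N=n]) (auto simp: up_rate_def down_rate_def)
  also have "\<dots> \<le> (\<Sum>i=1..n. a i * z * ((1 + z) * (1 + clusters y)) + b (i + 1) * ((1 + z) * (1 + clusters y)))"
  proof (intro sum_mono add_mono mult_left_mono c)
    fix i assume i: "i \<in> {1..n}"
    show "0 \<le> a i * z" "0 \<le> b (i + 1)" using a_pos[of i] b_pos[of "i + 1"] z_pos i by auto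
  qed auto
  also have "\<dots> = growth * (1 + clusters y)"
    unfolding growth_def by (subst sum_distrib_right) (simp add: algebra_simps)
  finally show ?thesis .
qed

abbreviation qsd :: "(nat \<Rightarrow> nat) measure" where "qsd \<equiv> BD_qsd a b z n"

text \<open>
  A probability mass function with the same point masses; it provides normalisation.
\<close>

definition poisson_product :: "(nat \<Rightarrow> nat) pmf" where
  "poisson_product = Pi_pmf {2..n} 0 (\<lambda>i. poisson_pmf (f i))"

lemma pmf_poisson_product: "pmf poisson_product x = (if x \<in> E\<^sub>n then \<nu> x else 0)"
proof -
  have "(\<forall>j. j \<notin> {2..n} \<longrightarrow> x j = 0) \<longleftrightarrow> x \<in> E\<^sub>n"
  proof
    assume "x \<in> E\<^sub>n"
    show "\<forall>j. j \<notin> {2..n} \<longrightarrow> x j = 0"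
    proof (intro allI impI)
      fix j assume "j \<notin> {2..n}"
      then have "j = 0 \<or> j = 1 \<or> n < j" by auto
      with \<open>x \<in> E\<^sub>n\<close> show "x j = 0" by (auto simp: BD_states_upto_iff)
    qed
  qed (auto simp: BD_states_upto_iff)
  moreover have "(\<Prod>i=2..n. pmf (poisson_pmf (f i)) (x i)) = \<nu> x"
    unfolding \<nu>_def by (intro prod.cong refl pmf_poisson) (auto intro: less_imp_le f_pos)
  ultimately show ?thesis
    unfolding poisson_product_def by (subst pmf_Pi) auto
qed

lemma emeasure_qsd:
  assumes "B \<subseteq> BD_states"
  shows "emeasure qsd B = emeasure poisson_product B"
proof -
  have "emeasure qsd B = (\<integral>\<^sup>+x. ennreal (pmf poisson_product x) * indicator B x \<partial>count_space BD_states)"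
    using assms unfolding BD_qsd_def point_measure_def
    by (subst emeasure_density) (auto intro!: nn_integral_cong simp: pmf_poisson_product \<nu>_def)
  also have "\<dots> = (\<integral>\<^sup>+x. ennreal (pmf poisson_product x) \<partial>count_space B)"
    using assms
    by (subst (1 2) nn_integral_count_space_indicator) (auto intro!: nn_integral_cong split: split_indicator)
  also have "\<dots> = emeasure poisson_product B" by (rule nn_integral_pmf)
  finally show ?thesis .
qed

lemma space_qsd [simp]: "space qsd = BD_states"
  by (simp add: BD_qsd_def space_point_measure)

lemma set_pmf_poisson_product: "set_pmf poisson_product \<subseteq> E\<^sub>n"
  by (auto simp: set_pmf_eq pmf_poisson_product split: if_splits)

lemma prob_space_qsd: "prob_space qsd"
proof
  have "emeasure poisson_product BD_states = 1"
    using set_pmf_poisson_product E\<^sub>n_subset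
    by (intro measure_pmf.emeasure_eq_1_AE) (auto simp: AE_measure_pmf_iff)
  then show "emeasure qsd (space qsd) = 1" by (simp add: emeasure_qsd)
qed

lemma measure_qsd_singleton: "x \<in> BD_states \<Longrightarrow> measure qsd {x} = (if x \<in> E\<^sub>n then \<nu> x else 0)"
  by (simp add: measure_def emeasure_qsd emeasure_pmf_single pmf_poisson_product less_imp_le \<nu>_pos)

lemma nn_integral_qsd_singletons:
  assumes "B \<subseteq> BD_states"
  shows "(\<integral>\<^sup>+y. ennreal (measure qsd {y}) \<partial>count_space (B \<inter> E\<^sub>n)) = emeasure qsd B"
proof -
  have "(\<integral>\<^sup>+y. ennreal (measure qsd {y}) \<partial>count_space (B \<inter> E\<^sub>n)) =
    (\<integral>\<^sup>+y. ennreal (pmf poisson_product y) \<partial>count_space (B \<inter> E\<^sub>n))"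
    using E\<^sub>n_subset by (intro nn_integral_cong) (auto simp: measure_qsd_singleton pmf_poisson_product)
  also have "\<dots> = emeasure poisson_product (B \<inter> E\<^sub>n)" by (rule nn_integral_pmf)
  also have "\<dots> = emeasure poisson_product B"
    using set_pmf_poisson_product by (intro emeasure_eq_AE) (auto simp: AE_measure_pmf_iff)
  also have "\<dots> = emeasure qsd B" using assms by (simp add: emeasure_qsd)
  finally show ?thesis .
qed

end

section \<open>Exit times and the quasi-stationary law\<close>

text \<open>
  Paths are constant on the right-open sojourn intervals, so up to time \<open>t\<close> the process visits
  exactly the states \<open>y 0, ..., y k\<close>, and the exit, if any, comes no earlier than the end of the
  current interval. After an explosion the process is at \<open>None\<close>, which counts as an exit.
\<close>

lemma before_exit_iff:
  fixes s :: "nat \<Rightarrow> real"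
  defines "T \<equiv> \<lambda>k. \<Sum>i<k. s i"
  assumes s: "\<And>k. 0 < s k" and t: "0 \<le> t"
    and X: "\<And>t k. 0 \<le> t \<Longrightarrow> T k \<le> t \<Longrightarrow> t < T (Suc k) \<Longrightarrow> X t \<omega> = Some (y k)"
    and X_None: "\<And>t. 0 \<le> t \<Longrightarrow> (\<And>k. T k \<le> t) \<Longrightarrow> X t \<omega> = None"
  shows "ereal t < exit_time F X \<omega> \<longleftrightarrow> (\<exists>k. (\<forall>i\<le>k. y i \<in> F) \<and> T k \<le> t \<and> t < T (Suc k))"
proof -
  have T_mono: "mono T"
    using s by (intro mono_iff_le_Suc[THEN iffD2]) (auto simp: T_def less_imp_le)
  have T0: "T 0 = 0" by (simp add: T_def)
  have T_less: "T k < T (Suc k)" for k using s[of k] by (simp add: T_def)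
  have T_nonneg: "0 \<le> T k" for k using monoD[OF T_mono, of 0 k] T0 by simp
  have ex: "\<exists>k. T k \<le> r \<and> r < T (Suc k)" if r: "0 \<le> r" "r < T m" for r m
  proof -
    define l where "l = (LEAST l. r < T l)"
    have l: "r < T l" unfolding l_def using r(2) by (rule LeastI)
    then obtain k where k: "l = Suc k" using l T0 r(1) by (cases l) auto
    have "\<not> r < T k" using not_less_Least[of k "\<lambda>l. r < T l"] k by (simp add: l_def[symmetric])
    with l k show ?thesis by (auto intro!: exI[of _ k])
  qed
  show ?thesis
  proof
    assume less: "ereal t < exit_time F X \<omega>"
    have inF: "X r \<omega> \<in> Some ` F" if "0 \<le> r" "r \<le> t" for r
    proof (rule ccontr)
      assume "X r \<omega> \<notin> Some ` F"
      then have "exit_time F X \<omega> \<le> ereal r"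
        unfolding exit_time_def using that by (intro Inf_lower) auto
      also have "\<dots> \<le> ereal t" using that by simp
      finally show False using less by simp
    qed
    have "\<exists>m. t < T m"
    proof (rule ccontr)
      assume "\<nexists>m. t < T m"
      then have "X t \<omega> = None" using t by (intro X_None) (auto simp: not_less)
      with inF[OF t] show False by auto
    qed
    then obtain k where k: "T k \<le> t" "t < T (Suc k)" using ex[OF t] by blast
    have "y i \<in> F" if "i \<le> k" for i
    proof -
      have "X (T i) \<omega> = Some (y i)" using T_nonneg T_less by (intro X) auto
      moreover have "T i \<le> t" using monoD[OF T_mono that] k by simp
      ultimately show ?thesis using inF[OF T_nonneg, of i] by auto
    qed
    with k show "\<exists>k. (\<forall>i\<le>k. y i \<in> F) \<and> T k \<le> t \<and> t < T (Suc k)" by blast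
  next
    assume "\<exists>k. (\<forall>i\<le>k. y i \<in> F) \<and> T k \<le> t \<and> t < T (Suc k)"
    then obtain k where k: "\<forall>i\<le>k. y i \<in> F" "T k \<le> t" "t < T (Suc k)" by blast
    have "ereal (T (Suc k)) \<le> exit_time F X \<omega>"
      unfolding exit_time_def
    proof (rule Inf_greatest)
      fix e assume "e \<in> ereal ` {t. 0 \<le> t \<and> X t \<omega> \<notin> Some ` F}"
      then obtain r where r: "e = ereal r" "0 \<le> r" "X r \<omega> \<notin> Some ` F" by auto
      have "T (Suc k) \<le> r"
      proof (rule ccontr)
        assume "\<not> T (Suc k) \<le> r"
        then obtain j where j: "T j \<le> r" "r < T (Suc j)" using ex[of r "Suc k"] r(2) by auto
        then have "T j < T (Suc k)" using \<open>\<not> T (Suc k) \<le> r\<close> by simp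
        then have "j \<le> k" using monoD[OF T_mono, of "Suc k" j] by (meson not_less not_less_eq_eq)
        then have "X r \<omega> \<in> Some ` F" using k(1) X[OF r(2) j] by auto
        with r show False by simp
      qed
      with r show "ereal (T (Suc k)) \<le> e" by simp
    qed
    with k(3) show "ereal t < exit_time F X \<omega>"
      by (meson ereal_less_eq(3) less_ereal.simps(1) less_le_trans)
  qed
qed

lemma sojourn_interval_unique:
  fixes s :: "nat \<Rightarrow> real"
  assumes s: "\<And>k. 0 < s k"
    and "(\<Sum>i<k. s i) \<le> t" "t < (\<Sum>i<Suc k. s i)" "(\<Sum>i<j. s i) \<le> t" "t < (\<Sum>i<Suc j. s i)"
  shows "j = k"
proof -
  have mono: "mono (\<lambda>k. \<Sum>i<k. s i)"
    using s by (intro mono_iff_le_Suc[THEN iffD2]) (auto simp: less_imp_le)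
  show ?thesis
  proof (cases j k rule: linorder_cases)
    case less
    then show ?thesis using monoD[OF mono, of "Suc j" k] assms(2,5) by simp
  next
    case greater
    then show ?thesis using monoD[OF mono, of "Suc k" j] assms(3,4) by simp
  qed
qed

context quasi_stationary_jump_hold_process
begin

text \<open>
  The event is decomposed by the current state and the number of jumps, and \<open>suminf_occ\<close> adds up the
  pieces.
\<close>

lemma emeasure_before_exit:
  assumes "0 \<le> t"
  shows "emeasure M {\<omega>\<in>space M. \<exists>k. (\<forall>i\<le>k. Y i \<omega> \<in> F) \<and> Y k \<omega> \<in> B \<and>
      jump_time k \<omega> \<le> t \<and> t < jump_time (Suc k) \<omega>} =
    (\<integral>\<^sup>+y. ennreal (\<mu> y) \<partial>count_space (B \<inter> F)) * ennreal (exp (- J * t))"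
proof -
  define A where "A y k = {\<omega>\<in>space M. (\<forall>i\<le>k. Y i \<omega> \<in> F) \<and> Y k \<omega> = y \<and>
      jump_time k \<omega> \<le> t \<and> t < jump_time (Suc k) \<omega>}" for y k
  have A[measurable]: "A y k \<in> sets M" for y k unfolding A_def by measurable
  have same_k: "j = k" if "\<omega> \<in> A x j" "\<omega> \<in> A y k" for \<omega> x y j k
    using that S_pos[of \<omega>] unfolding A_def by (intro sojourn_interval_unique[of "\<lambda>i. S i \<omega>"]) auto
  have "{\<omega>\<in>space M. \<exists>k. (\<forall>i\<le>k. Y i \<omega> \<in> F) \<and> Y k \<omega> \<in> B \<and>
      jump_time k \<omega> \<le> t \<and> t < jump_time (Suc k) \<omega>} = (\<Union>y\<in>B \<inter> F. \<Union>k. A y k)"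
    by (auto simp: A_def)
  also have "emeasure M \<dots> = (\<integral>\<^sup>+y. emeasure M (\<Union>k. A y k) \<partial>count_space (B \<inter> F))"
  proof (rule emeasure_UN_countable)
    show "countable (B \<inter> F)" using countable_F by auto
    show "disjoint_family_on (\<lambda>y. \<Union>k. A y k) (B \<inter> F)"
      unfolding disjoint_family_on_def
    proof safe
      fix x y j k \<omega> assume *: "\<omega> \<in> A x j" "\<omega> \<in> A y k" "x \<noteq> y"
      then have "j = k" by (intro same_k)
      with * show "\<omega> \<in> {}" by (auto simp: A_def)
    qed
  qed simp
  also have "\<dots> = (\<integral>\<^sup>+y. ennreal (\<mu> y) * ennreal (exp (- J * t)) \<partial>count_space (B \<inter> F))"
  proof (rule nn_integral_cong)
    fix y assume "y \<in> space (count_space (B \<inter> F))"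
    then have y: "y \<in> F" by simp
    have "emeasure M (\<Union>k. A y k) = (\<Sum>k. emeasure M (A y k))"
      using same_k by (intro suminf_emeasure[symmetric]) (auto simp: disjoint_family_on_def)
    also have "\<dots> = (\<Sum>k. occ k y t)"
      unfolding A_def using y by (simp add: occ_law del: sum.lessThan_Suc)
    also have "\<dots> = ennreal (\<mu> y * exp (- J * t))" by (rule suminf_occ) (fact y, fact)
    finally show "emeasure M (\<Union>k. A y k) = ennreal (\<mu> y) * ennreal (exp (- J * t))"
      using F_facts[OF y] by (simp add: ennreal_mult)
  qed
  also have "\<dots> = (\<integral>\<^sup>+y. ennreal (\<mu> y) \<partial>count_space (B \<inter> F)) * ennreal (exp (- J * t))"
    by (rule nn_integral_multc) simp
  finally show ?thesis .
qed

end

theorem (in truncated_becker_doering) qsd_before_exit: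
  fixes M :: "'w measure"
  assumes X: "is_ctmc (BD_generator a b z) BD_states qsd M X" and t: "0 \<le> t" and B: "B \<subseteq> BD_states"
  shows "measure M {\<omega>\<in>space M. X t \<omega> \<in> Some ` B \<and> ereal t < exit_time E\<^sub>n X \<omega>} =
    measure qsd B * exp (- J * t)"
proof -
  obtain Y :: "nat \<Rightarrow> 'w \<Rightarrow> nat \<Rightarrow> nat" and S :: "nat \<Rightarrow> 'w \<Rightarrow> real" where
    Y: "\<forall>k. Y k \<in> measurable M (count_space BD_states)" and
    S: "\<forall>k. S k \<in> borel_measurable M" and
    S_pos: "\<forall>k. \<forall>\<omega>\<in>space M. 0 < S k \<omega>" and
    cyl: "\<forall>k x s. (\<forall>i\<le>k. x i \<in> BD_states \<and> 0 \<le> s i) \<longrightarrow>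
           measure M {\<omega>\<in>space M. \<forall>i\<le>k. Y i \<omega> = x i \<and> s i < S i \<omega>} =
             measure qsd {x 0} * (\<Prod>i<k. jump (x i) (x (Suc i)))
               * (\<Prod>i\<le>k. exp (- rate (x i) * s i))" and
    path: "\<forall>\<omega>\<in>space M. \<forall>t\<ge>0.
           (\<forall>k. (\<Sum>i<k. S i \<omega>) \<le> t \<and> t < (\<Sum>i<Suc k. S i \<omega>) \<longrightarrow> X t \<omega> = Some (Y k \<omega>)) \<and>
           ((\<forall>k. (\<Sum>i<k. S i \<omega>) \<le> t) \<longrightarrow> X t \<omega> = None)"
    using X unfolding is_ctmc_def by (elim conjE exE) (rule that)
  have M: "prob_space M" using X unfolding is_ctmc_def by (rule conjunct1)
  have X_Some: "X t \<omega> = Some (Y k \<omega>)"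
    if "\<omega> \<in> space M" "0 \<le> t" "(\<Sum>i<k. S i \<omega>) \<le> t" "t < (\<Sum>i<Suc k. S i \<omega>)" for \<omega> t k
    using path that by blast
  have X_None: "X t \<omega> = None"
    if "\<omega> \<in> space M" "0 \<le> t" "\<And>k. (\<Sum>i<k. S i \<omega>) \<le> t" for \<omega> t
    using path that by blast
  interpret quasi_stationary_jump_hold_process M Y S BD_states E\<^sub>n "\<lambda>x. measure qsd {x}" rate jump J growth clusters
  proof (rule quasi_stationary_jump_hold_process.intro)
    show "jump_hold_process M Y S BD_states E\<^sub>n (\<lambda>x. measure qsd {x}) rate jump"
    proof (rule jump_hold_process.intro[OF M], rule jump_hold_process_axioms.intro)
      fix k and x :: "nat \<Rightarrow> nat \<Rightarrow> nat" and s :: "nat \<Rightarrow> real"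
      assume "\<And>i. i \<le> k \<Longrightarrow> x i \<in> BD_states \<and> 0 \<le> s i"
      then show "measure M {\<omega>\<in>space M. \<forall>i\<le>k. Y i \<omega> = x i \<and> s i < S i \<omega>} =
          measure qsd {x 0} * (\<Prod>i<k. jump (x i) (x (Suc i))) * (\<Prod>i\<le>k. exp (- rate (x i) * s i))"
        using cyl by blast
    next
      show "E\<^sub>n \<subseteq> BD_states" by (rule E\<^sub>n_subset)
    qed (use countable_BD_states Y S S_pos rate_pos jump_nonneg in \<open>simp_all\<close>)
    show "quasi_stationary_jump_hold_process_axioms E\<^sub>n (\<lambda>x. measure qsd {x}) rate jump J growth clusters"
    proof
      fix y assume y: "y \<in> E\<^sub>n"
      have "(\<integral>\<^sup>+x. ennreal (measure qsd {x}) * ennreal (jump x y * rate x) \<partial>count_space E\<^sub>n) =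
        (\<integral>\<^sup>+x. ennreal (\<nu> x) * ennreal (jump x y * rate x) \<partial>count_space E\<^sub>n)"
        using E\<^sub>n_subset by (intro nn_integral_cong) (auto simp: measure_qsd_singleton)
      also have "\<dots> = ennreal (measure qsd {y} * (rate y - J))"
        using y E\<^sub>n_subset by (auto simp: \<nu>_balance measure_qsd_singleton)
      finally show "(\<integral>\<^sup>+x. ennreal (measure qsd {x}) * ennreal (jump x y * rate x) \<partial>count_space E\<^sub>n) =
         ennreal (measure qsd {y} * (rate y - J))" .
    qed (use J_pos growth_pos in \<open>auto intro: J_le_rate clusters_nonneg clusters_jump rate_growth\<close>)
  qed
  have exit: "ereal t < exit_time E\<^sub>n X \<omega> \<longleftrightarrow>
      (\<exists>k. (\<forall>i\<le>k. Y i \<omega> \<in> E\<^sub>n) \<and> jump_time k \<omega> \<le> t \<and> t < jump_time (Suc k) \<omega>)"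
    if "\<omega> \<in> space M" for \<omega>
    by (rule before_exit_iff[where y="\<lambda>k. Y k \<omega>"])
      (use that S_pos t X_Some[OF that] X_None[OF that] in \<open>simp_all del: sum.lessThan_Suc\<close>)
  have "{\<omega>\<in>space M. X t \<omega> \<in> Some ` B \<and> ereal t < exit_time E\<^sub>n X \<omega>} =
    {\<omega>\<in>space M. \<exists>k. (\<forall>i\<le>k. Y i \<omega> \<in> E\<^sub>n) \<and> Y k \<omega> \<in> B \<and> jump_time k \<omega> \<le> t \<and> t < jump_time (Suc k) \<omega>}"
  proof (intro Collect_cong conj_cong refl)
    fix \<omega> assume \<omega>: "\<omega> \<in> space M"
    show "X t \<omega> \<in> Some ` B \<and> ereal t < exit_time E\<^sub>n X \<omega> \<longleftrightarrow>
      (\<exists>k. (\<forall>i\<le>k. Y i \<omega> \<in> E\<^sub>n) \<and> Y k \<omega> \<in> B \<and> jump_time k \<omega> \<le> t \<and> t < jump_time (Suc k) \<omega>)"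
      (is "?L \<longleftrightarrow> ?R")
    proof
      assume ?L
      then obtain k where k: "\<forall>i\<le>k. Y i \<omega> \<in> E\<^sub>n" "jump_time k \<omega> \<le> t" "t < jump_time (Suc k) \<omega>"
        unfolding exit[OF \<omega>] by blast
      with \<open>?L\<close> have "Y k \<omega> \<in> B" using X_Some[OF \<omega> t k(2,3)] by auto
      with k show ?R by blast
    next
      assume ?R
      then obtain k where k: "\<forall>i\<le>k. Y i \<omega> \<in> E\<^sub>n" "Y k \<omega> \<in> B" "jump_time k \<omega> \<le> t" "t < jump_time (Suc k) \<omega>"
        by blast
      then have "X t \<omega> \<in> Some ` B" using X_Some[OF \<omega> t k(3,4)] by auto
      with k show ?L unfolding exit[OF \<omega>] by blast
    qed
  qed
  then have "emeasure M {\<omega>\<in>space M. X t \<omega> \<in> Some ` B \<and> ereal t < exit_time E\<^sub>n X \<omega>} =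
      emeasure qsd B * ennreal (exp (- J * t))"
    using B by (simp add: emeasure_before_exit[OF t] nn_integral_qsd_singletons del: sum.lessThan_Suc)
  then show ?thesis
    by (simp add: measure_def enn2real_mult)
qed

theorem proposition5p1:
  fixes a b :: "nat \<Rightarrow> real" and z :: real and n :: nat
  assumes "z > 0"
    and "\<And>i. i \<ge> 1 \<Longrightarrow> a i > 0"
    and "\<And>i. i \<ge> 2 \<Longrightarrow> b i > 0"
    and "(\<Sum>\<^sub>\<infinity>m\<in>{2..}. ennreal (BD_Q a b m * z ^ m) *
            (\<Sum>\<^sub>\<infinity>k\<in>{m..}. ennreal (1 / (a k * BD_Q a b k * z ^ (k + 1))))) = \<infinity>"
    and "n \<ge> 2"
  shows "prob_space (BD_qsd a b z n) \<and>
    (\<forall>(M :: 'w measure) X.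
       is_ctmc (BD_generator a b z) BD_states (BD_qsd a b z n) M X \<longrightarrow>
       (\<forall>t\<ge>0.
          (\<forall>B\<subseteq>BD_states.
             \<P>(\<omega> in M. X t \<omega> \<in> Some ` B \<bar> ereal t < exit_time (BD_states_upto n) X \<omega>)
               = measure (BD_qsd a b z n) B) \<and>
          \<P>(\<omega> in M. ereal t < exit_time (BD_states_upto n) X \<omega>) = exp (- BD_J a b z n * t)))"
proof -
  interpret truncated_becker_doering a b z n
    using assms by unfold_locales auto
  interpret qsd: prob_space qsd by (rule prob_space_qsd)
  show ?thesis
  proof (intro conjI allI impI)
    show "prob_space qsd" by (rule prob_space_qsd)
    fix M :: "'w measure" and X and t :: real
    assume X: "is_ctmc (BD_generator a b z) BD_states qsd M X" and t: "0 \<le> t"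
    have in_states: "X t \<omega> \<in> Some ` BD_states" if "ereal t < exit_time E\<^sub>n X \<omega>" for \<omega>
    proof (rule ccontr)
      assume "X t \<omega> \<notin> Some ` BD_states"
      then have "exit_time E\<^sub>n X \<omega> \<le> ereal t"
        unfolding exit_time_def using t E\<^sub>n_subset by (intro Inf_lower) auto
      with that show False by simp
    qed
    then have "{\<omega>\<in>space M. ereal t < exit_time E\<^sub>n X \<omega>} =
        {\<omega>\<in>space M. X t \<omega> \<in> Some ` BD_states \<and> ereal t < exit_time E\<^sub>n X \<omega>}" by auto
    then show survival: "\<P>(\<omega> in M. ereal t < exit_time E\<^sub>n X \<omega>) = exp (- J * t)"
      using qsd_before_exit[OF X t subset_refl] qsd.prob_space by simp
    fix B assume "B \<subseteq> BD_states"
    then show "\<P>(\<omega> in M. X t \<omega> \<in> Some ` B \<bar> ereal t < exit_time E\<^sub>n X \<omega>) = measure qsd B"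
      unfolding cond_prob_def survival by (simp add: qsd_before_exit[OF X t])
  qed
qed

end
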